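(* Let $\mu$ be a singular cardinal, and suppose there is a scale $(\vec{\mu},\vec{f})$ for $\mu$, with $\vec\mu=\langle\mu_i:i<\operatorname{cf}(\mu)\rangle$, such that $\mu_i\nrightarrow[(\mu_i:\mu_i)]^2_{\mu_i}$ for all $i<\operatorname{cf}(\mu)$. Then $\mathrm{Pr}_1(\mu^+,\mu^+,\mu^+,\operatorname{cf}(\mu))$ holds.
   Context: A scale for a singular cardinal $\mu$ is a pair $(\vec\mu,\vec f)$ where $\vec{\mu}=\langle\mu_i:i<\operatorname{cf}(\mu)\rangle$ is an increasing sequence of regular cardinals with supremum $\mu$ and $\operatorname{cf}(\mu)<\mu_0$, and $\vec{f}=\langle f_\alpha:\alpha<\mu^+\rangle$ satisfies: each $f_\alpha\in\prod_{i<\operatorname{cf}(\mu)}\mu_i$; if $\gamma<\beta<\mu^+$ then $f_\gamma<^* f_\beta$ (meaning $\{i:f_\beta(i)\le f_\gamma(i)\}$ is bounded in $\operatorname{cf}(\mu)$); and every $f\in\prod_{i}\mu_i$ satisfies $f<^*f_\alpha$ for some $\alpha<\mu^+$. For a regular cardinal $\kappa$, $\kappa\nrightarrow[(\kappa:\kappa)]^2_\kappa$ means there is a function $d:[\kappa]^2\rightarrow\kappa$ such that for any unbounded $A,B\subseteq\kappa$ and any $\varsigma<\kappa$ there are $\alpha\in A$, $\beta\in B$, $\alpha\neq\beta$, with $d(\{\alpha,\beta\})=\varsigma$. $\mathrm{Pr}_1(\mu^+,\mu^+,\mu^+,\operatorname{cf}(\mu))$ means: there is $f:[\mu^+]^2\rightarrow\mu^+$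 such that whenever $\langle t_\alpha:\alpha<\mu^+\rangle$ is a sequence of pairwise disjoint subsets of $\mu^+$ each of cardinality less than $\operatorname{cf}(\mu)$, then for every $\epsilon<\mu^+$ there are $\alpha<\beta<\mu^+$ with $f(\{\epsilon_a,\epsilon_b\})=\epsilon$ for all $\epsilon_a\in t_\alpha$, $\epsilon_b\in t_\beta$. *)

theory Defs
  imports Main "HOL-Library.FuncSet" "HOL-Library.Disjoint_Sets" "HOL-Library.Ramsey"
begin

unbundle cardinal_syntax

text \<open>
  A cardinal is a relation \<open>r\<close> with \<open>Card_order r\<close>, i.e. an initial well-order on its field.
  The ordinals below it are the elements of \<open>Field r\<close>; in von Neumann style, the ordinal
  \<open>a \<in> Field r\<close> is identified with the set \<open>underS r a\<close> of its strict predecessors, so that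
  \<open>a < b\<close> reads \<open>a \<in> underS r b\<close>. As every infinite cardinal is a limit ordinal,
  \<open>cofinal A r\<close> says that \<open>A\<close> is unbounded in \<open>r\<close>.
\<close>

definition seg :: "'a rel \<Rightarrow> 'a \<Rightarrow> 'a rel" where
  "seg r a = Restr r (underS r a)"

definition singular_card :: "'a rel \<Rightarrow> bool" where
  "singular_card r \<longleftrightarrow> Cinfinite r \<and> \<not> regularCard r"

definition regular_card :: "'a rel \<Rightarrow> bool" where
  "regular_card r \<longleftrightarrow> Cinfinite r \<and> regularCard r"

text \<open>
  The least ordinal admitting a cofinal map into \<open>r\<close>, as an element of \<open>Field r\<close>.
  Only meaningful for singular \<open>r\<close>, where this ordinal is strictly below \<open>r\<close>.
\<close>

definition cf :: "'a rel \<Rightarrow> 'a" where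
  "cf r = wo_rel.minim r
     {c \<in> Field r. \<exists>g \<in> underS r c \<rightarrow> Field r. cofinal (g ` underS r c) r}"

definition bounded_in :: "'a rel \<Rightarrow> 'a set \<Rightarrow> bool" where
  "bounded_in k S \<longleftrightarrow> (\<exists>j \<in> Field k. \<forall>i \<in> S. (i, j) \<in> k)"

definition less_star :: "'a rel \<Rightarrow> ('a \<Rightarrow> 'a) \<Rightarrow> ('a \<Rightarrow> 'a) \<Rightarrow> bool" where
  "less_star r f g \<longleftrightarrow>
     bounded_in (seg r (cf r)) {i \<in> underS r (cf r). (g i, f i) \<in> r}"

text \<open>
  The clause \<open>cofinal (M ` _) r\<close> expresses that the supremum of the \<open>M i\<close> is \<open>r\<close> itself;
  \<open>wo_rel.minim r (Field r)\<close> is the ordinal \<open>0\<close>.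
\<close>

definition scale :: "'a rel \<Rightarrow> ('a \<Rightarrow> 'a) \<Rightarrow> ('a set \<Rightarrow> 'a \<Rightarrow> 'a) \<Rightarrow> bool" where
  "scale r M F \<longleftrightarrow>
     (\<forall>i \<in> underS r (cf r). M i \<in> Field r \<and> regular_card (seg r (M i))) \<and>
     (\<forall>j \<in> underS r (cf r). \<forall>i \<in> underS r j. M i \<in> underS r (M j)) \<and>
     cofinal (M ` underS r (cf r)) r \<and>
     cf r \<in> underS r (M (wo_rel.minim r (Field r))) \<and>
     (\<forall>\<alpha> \<in> Field (cardSuc r). F \<alpha> \<in> (\<Pi> i \<in> underS r (cf r). underS r (M i))) \<and>
     (\<forall>\<beta> \<in> Field (cardSuc r). \<forall>\<gamma> \<in> underS (cardSuc r) \<beta>. less_star r (F \<gamma>) (F \<beta>)) \<and>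
     (\<forall>f \<in> (\<Pi> i \<in> underS r (cf r). underS r (M i)).
        \<exists>\<alpha> \<in> Field (cardSuc r). less_star r f (F \<alpha>))"

text \<open>\<open>k \<nrightarrow> [(k : k)]\<^sup>2\<^sub>k\<close>\<close>

definition neg_rect_partition :: "'a rel \<Rightarrow> bool" where
  "neg_rect_partition k \<longleftrightarrow>
     (\<exists>d \<in> nsets (Field k) 2 \<rightarrow> Field k.
        \<forall>A B. A \<subseteq> Field k \<and> B \<subseteq> Field k \<and> cofinal A k \<and> cofinal B k \<longrightarrow>
          (\<forall>\<sigma> \<in> Field k. \<exists>\<alpha> \<in> A. \<exists>\<beta> \<in> B. \<alpha> \<noteq> \<beta> \<and> d {\<alpha>, \<beta>} = \<sigma>))"

definition Pr1 :: "'a rel \<Rightarrow> 'b rel \<Rightarrow> 'c rel \<Rightarrow> 'd rel \<Rightarrow> bool" where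
  "Pr1 l m s \<theta> \<longleftrightarrow>
     (\<exists>f \<in> nsets (Field l) 2 \<rightarrow> Field s.
        \<forall>t :: 'b \<Rightarrow> 'a set.
          (\<forall>\<alpha> \<in> Field m. t \<alpha> \<subseteq> Field l \<and> |t \<alpha>| <o \<theta>) \<and> disjoint_family_on t (Field m) \<longrightarrow>
          (\<forall>\<epsilon> \<in> Field s. \<exists>\<beta> \<in> Field m. \<exists>\<alpha> \<in> underS m \<beta>.
             \<forall>a \<in> t \<alpha>. \<forall>b \<in> t \<beta>. f {a, b} = \<epsilon>))"

end

theory Submission
  imports Defs
begin

text \<open>
  Write \<open>\<kappa> = cf \<mu>\<close>, \<open>\<lambda> = \<mu>\<^sup>+\<close>, and for \<open>a < b < \<lambda>\<close> let \<open>j\<close> be the last coordinate with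
  \<open>f\<^sub>b(j) \<le> f\<^sub>a(j)\<close>. For any disjoint family of sets of size \<open>< \<kappa>\<close> this \<open>j\<close> can be made constant on a
  rectangle \<open>t\<^sub>\<alpha> \<times> t\<^sub>\<beta>\<close> and prescribed up to a bound, so it can encode indices \<open>i, i', k < \<kappa>\<close>.

  Club guessing yields sets \<open>B(b,i) \<subseteq> b + 1\<close> of size at most \<open>\<mu>\<^sub>i\<close>, transitive in \<open>b\<close> and exhausting
  \<open>b\<close> as \<open>i\<close> grows, such that every club contains, for suitable \<open>\<delta>\<close> and arbitrarily large \<open>i\<close>, some
  \<open>e \<in> B(\<delta>,i)\<close> of cofinality above \<open>\<mu>\<^sub>i\<close>. Such an \<open>e\<close> sits above a gap of all the \<open>B(b,i)\<close> with
  \<open>b \<in> t\<^sub>\<beta>\<close> at once, and pressing down makes the lower end of the gap independent of \<open>e\<close>. Hence one can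
  recover from any \<open>a \<in> t\<^sub>\<alpha>\<close>, \<open>b \<in> t\<^sub>\<beta>\<close> two ordinals: \<open>e'\<close>, the first point of \<open>B(b,i')\<close> above \<open>a\<close>, and
  \<open>e\<close>, the first point of \<open>B(a,i)\<close> above \<open>B(b,i') \<inter> a\<close>. Both depend on the rectangle only, and the pairs
  \<open>(e, e')\<close> range over a full rectangle of unbounded sets. The colouring of \<open>\<mu>\<^sub>k\<close> applied to \<open>f\<^sub>e(k)\<close>
  and \<open>f\<^sub>e\<^sub>'(k)\<close> therefore takes every value below \<open>\<mu>\<^sub>k\<close>, and reading this value through an
  injection of \<open>e'\<close> into \<open>\<mu>\<close> produces every colour below \<open>\<lambda>\<close>.
\<close>

section \<open>Bounds for cardinalities\<close>

lemma finite_ordLess_infinite_card: "finite A \<Longrightarrow> infinite B \<Longrightarrow> |A| <o |B|"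
  by (metis card_of_ordLess finite_imageD finite_subset)

lemma card_of_Un_le:
  assumes "infinite C" "|A| \<le>o |C|" "|B| \<le>o |C|" shows "|A \<union> B| \<le>o |C|"
  by (rule card_of_Un_ordLeq_infinite_Field) (use assms in \<open>simp_all add: card_of_card_order_on Field_card_of\<close>)

lemma card_of_Times_le:
  assumes "infinite C" "|A| \<le>o |C|" "|B| \<le>o |C|" shows "|A \<times> B| \<le>o |C|"
  by (rule card_of_Times_ordLeq_infinite_Field)
    (use assms in \<open>simp_all add: card_of_card_order_on Field_card_of\<close>)

lemma card_of_singleton_le: "infinite C \<Longrightarrow> |{x}| \<le>o |C|"
  using finite_ordLess_infinite_card[of "{x}" C] ordLess_imp_ordLeq by blast

text \<open>The two orders are total on their types and extend those of \<open>\<lambda>\<close> and \<open>\<mu>\<close>, which makes the theory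
  of the type class \<^class>\<open>wellorder\<close> available on the carriers \<open>L\<close>, \<open>K\<close>, \<open>N\<close>, the sets of
  ordinals below \<open>\<lambda>\<close>, \<open>\<kappa>\<close>, \<open>\<mu>\<close>.\<close>

locale singular_scale =
  L: wellorder lel ltl + A: wellorder lea lta
  for lel :: "'l \<Rightarrow> 'l \<Rightarrow> bool" (infix "\<unlhd>" 50) and ltl (infix "\<lhd>" 50)
    and lea :: "'a \<Rightarrow> 'a \<Rightarrow> bool" (infix "\<sqsubseteq>" 50) and lta (infix "\<sqsubset>" 50) +
  fixes L :: "'l set" and K N :: "'a set" and Mu :: "'a \<Rightarrow> 'a set" and f :: "'l \<Rightarrow> 'a \<Rightarrow> 'a"
  assumes L_bdd: "X \<subseteq> L \<Longrightarrow> |X| \<le>o |N| \<Longrightarrow> \<exists>z\<in>L. \<forall>x\<in>X. x \<lhd> z"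
    and L_seg: "x \<in> L \<Longrightarrow> |{y\<in>L. y \<lhd> x}| \<le>o |N|"
    and K_infinite: "infinite K"
    and K_bdd: "S \<subseteq> K \<Longrightarrow> |S| <o |K| \<Longrightarrow> \<exists>j\<in>K. \<forall>c\<in>S. c \<sqsubset> j"
    and K_seg: "j \<in> K \<Longrightarrow> |{i\<in>K. i \<sqsubset> j}| <o |K|"
    and K_Mu: "i \<in> K \<Longrightarrow> |K| <o |Mu i|"
    and Mu_bdd: "i \<in> K \<Longrightarrow> S \<subseteq> Mu i \<Longrightarrow> |S| <o |Mu i| \<Longrightarrow> \<exists>b\<in>Mu i. \<forall>c\<in>S. c \<sqsubset> b"
    and Mu_less: "i \<in> K \<Longrightarrow> j \<in> K \<Longrightarrow> i \<sqsubset> j \<Longrightarrow> |Mu i| <o |Mu j|"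
    and Mu_mono: "i \<in> K \<Longrightarrow> j \<in> K \<Longrightarrow> i \<sqsubset> j \<Longrightarrow> Mu i \<subseteq> Mu j"
    and Mu_N: "(\<Union>i\<in>K. Mu i) = N"
    and f_Mu: "x \<in> L \<Longrightarrow> i \<in> K \<Longrightarrow> f x i \<in> Mu i"
    and f_less: "x \<in> L \<Longrightarrow> y \<in> L \<Longrightarrow> x \<lhd> y \<Longrightarrow> \<exists>j\<in>K. \<forall>i\<in>K. j \<sqsubset> i \<longrightarrow> f x i \<sqsubset> f y i"
    and f_dom: "\<forall>i\<in>K. g i \<in> Mu i \<Longrightarrow> \<exists>x\<in>L. \<exists>j\<in>K. \<forall>i\<in>K. j \<sqsubset> i \<longrightarrow> g i \<sqsubset> f x i"
begin

section \<open>Consequences of regularity\<close>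

lemma L_bdd_image:
  assumes "|I| \<le>o |N|" "\<And>i. i \<in> I \<Longrightarrow> g i \<in> L"
  shows "\<exists>z\<in>L. \<forall>i\<in>I. g i \<lhd> z"
  using L_bdd[of "g ` I"] assms ordLeq_transitive[OF card_of_image[of g I]] by auto

lemma Mu_bdd_image:
  assumes "i \<in> K" "|I| <o |Mu i|" "\<And>x. x \<in> I \<Longrightarrow> g x \<in> Mu i"
  shows "\<exists>z\<in>Mu i. \<forall>x\<in>I. g x \<sqsubset> z"
  using Mu_bdd[of i "g ` I"] assms ordLeq_ordLess_trans[OF card_of_image[of g I]] by auto

lemma K_bdd_image:
  assumes "|I| <o |K|" "\<And>x. x \<in> I \<Longrightarrow> g x \<in> K"
  shows "\<exists>z\<in>K. \<forall>x\<in>I. g x \<sqsubset> z"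
  using K_bdd[of "g ` I"] assms ordLeq_ordLess_trans[OF card_of_image[of g I]] by auto

lemma K_greater: "j \<in> K \<Longrightarrow> \<exists>i\<in>K. j \<sqsubset> i"
  using K_bdd[of "{j}"] K_infinite finite_ordLess_infinite_card[of "{j}" K] by auto

lemma L_upper2: "x \<in> L \<Longrightarrow> y \<in> L \<Longrightarrow> \<exists>z\<in>L. x \<unlhd> z \<and> y \<unlhd> z"
  by (metis L.linear L.order_refl)

lemma K_upper2: "x \<in> K \<Longrightarrow> y \<in> K \<Longrightarrow> \<exists>z\<in>K. x \<sqsubseteq> z \<and> y \<sqsubseteq> z"
  by (metis A.linear A.order_refl)

lemma K_nonempty: "K \<noteq> {}"
  using K_infinite by auto

lemma Mu_infinite: "i \<in> K \<Longrightarrow> infinite (Mu i)"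
  using card_of_ordLeq_infinite[OF ordLess_imp_ordLeq[OF K_Mu]] K_infinite by blast

lemma Mu_subset: "i \<in> K \<Longrightarrow> Mu i \<subseteq> N"
  using Mu_N by blast

lemma Mu_le_N: "i \<in> K \<Longrightarrow> |Mu i| \<le>o |N|"
  using Mu_subset card_of_mono1 by blast

lemma N_infinite: "infinite N"
  using K_nonempty Mu_infinite Mu_subset finite_subset by (metis all_not_in_conv)

lemma Mu_le: "i \<in> K \<Longrightarrow> j \<in> K \<Longrightarrow> i \<sqsubseteq> j \<Longrightarrow> |Mu i| \<le>o |Mu j|"
  using Mu_mono[of i j] by (cases "i = j") (auto simp: A.le_less intro: card_of_mono1)

lemma Mu_greater: "i \<in> K \<Longrightarrow> z \<in> Mu i \<Longrightarrow> \<exists>x\<in>Mu i. z \<sqsubset> x"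
  using Mu_bdd[of i "{z}"] Mu_infinite finite_ordLess_infinite_card[of "{z}" "Mu i"] by auto

lemma K_le_N: "|K| \<le>o |N|"
proof -
  obtain i where "i \<in> K" using K_nonempty by blast
  then show ?thesis using ordLeq_transitive[OF ordLess_imp_ordLeq[OF K_Mu] Mu_le_N] by blast
qed

lemma L_greater: "x \<in> L \<Longrightarrow> \<exists>z\<in>L. x \<lhd> z"
  using L_bdd[of "{x}"] N_infinite finite_ordLess_infinite_card[of "{x}" N] ordLess_imp_ordLeq by auto

section \<open>Unbounded subsets of \<lambda> and the values of the scale on them\<close>

definition unb :: "'l set \<Rightarrow> bool" where
  "unb X \<longleftrightarrow> X \<subseteq> L \<and> (\<forall>z\<in>L. \<exists>x\<in>X. z \<lhd> x)"

lemma unb_mono: "unb X \<Longrightarrow> X \<subseteq> Y \<Longrightarrow> Y \<subseteq> L \<Longrightarrow> unb Y"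
  unfolding unb_def by (meson subsetD)

lemma unb_above:
  assumes "unb X" "z \<in> L" shows "unb {x\<in>X. z \<lhd> x}"
  unfolding unb_def
proof (intro conjI ballI)
  show "{x\<in>X. z \<lhd> x} \<subseteq> L" using assms(1) by (auto simp: unb_def)
  fix w assume "w \<in> L"
  then obtain v where "v \<in> L" "w \<unlhd> v" "z \<unlhd> v"
    using assms(2) L_upper2[of w z] by blast
  moreover from this obtain x where "x \<in> X" "v \<lhd> x" using assms(1) unfolding unb_def by blast
  ultimately show "\<exists>x\<in>{x\<in>X. z \<lhd> x}. w \<lhd> x" by (auto intro!: bexI[of _ x])
qed

text \<open>Pigeonhole principle: if all fibres were bounded, their at most \<open>|N|\<close>
  bounds would have a common bound by regularity of \<lambda>, and this would bound
  \<open>V\<close>.\<close>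

lemma unb_fibre:
  assumes V: "unb V" and Z: "|Z| \<le>o |N|" and h: "\<And>x. x \<in> V \<Longrightarrow> h x \<in> Z"
  shows "\<exists>z\<in>Z. unb {x\<in>V. h x = z}"
proof (rule ccontr)
  assume neg: "\<not> ?thesis"
  have "\<forall>z\<in>Z. \<exists>w\<in>L. \<forall>x\<in>V. h x = z \<longrightarrow> x \<unlhd> w"
  proof
    fix z assume "z \<in> Z"
    with neg have "\<not> unb {x\<in>V. h x = z}" by blast
    then obtain w where "w \<in> L" "\<forall>x\<in>{x\<in>V. h x = z}. \<not> w \<lhd> x"
      using V unfolding unb_def by blast
    then show "\<exists>w\<in>L. \<forall>x\<in>V. h x = z \<longrightarrow> x \<unlhd> w" using L.not_less by blast
  qed
  then obtain w where w: "\<forall>z\<in>Z. w z \<in> L \<and> (\<forall>x\<in>V. h x = z \<longrightarrow> x \<unlhd> w z)" by metis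
  then obtain y where y: "y \<in> L" "\<forall>z\<in>Z. w z \<lhd> y" using L_bdd_image[OF Z, of w] by blast
  then obtain x where "x \<in> V" "y \<lhd> x" using V unfolding unb_def by blast
  then have "h x \<in> Z" using h by blast
  with w y(2) \<open>x \<in> V\<close> have "x \<unlhd> w (h x)" "w (h x) \<lhd> y" by blast+
  with \<open>y \<lhd> x\<close> show False by simp
qed

text \<open>The form a disjoint family takes after reindexing; that \<open>s x\<close> lies beyond
  \<open>x\<close> is what remains of disjointness.\<close>

definition family :: "('l \<Rightarrow> 'l set) \<Rightarrow> bool" where
  "family s \<longleftrightarrow> (\<forall>x\<in>L. s x \<subseteq> {y\<in>L. x \<unlhd> y} \<and> |s x| <o |K| )"

lemma family_singleton: "family (\<lambda>x. {x})"
  unfolding family_def using K_infinite finite_ordLess_infinite_card[of "{_}" K] by auto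

text \<open>A single \<open>f z\<close> dominates \<open>g\<close>. The members of
  \<open>s x\<close> lie beyond \<open>z\<close>, and their fewer than \<kappa> thresholds have a
  common bound because \<kappa> is regular.\<close>

lemma family_eventually_dominates:
  assumes s: "family s" and g: "\<forall>i\<in>K. g i \<in> Mu i"
  shows "\<exists>z\<in>L. \<forall>x\<in>L. z \<lhd> x \<longrightarrow> (\<exists>j\<in>K. \<forall>a\<in>s x. \<forall>i\<in>K. j \<sqsubset> i \<longrightarrow> g i \<sqsubset> f a i)"
proof -
  obtain z j0 where z: "z \<in> L" "j0 \<in> K" "\<forall>i\<in>K. j0 \<sqsubset> i \<longrightarrow> g i \<sqsubset> f z i" using f_dom[OF g] by blast
  have "\<exists>j\<in>K. \<forall>a\<in>s x. \<forall>i\<in>K. j \<sqsubset> i \<longrightarrow> g i \<sqsubset> f a i" if x: "x \<in> L" "z \<lhd> x" for x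
  proof -
    have "\<forall>a\<in>s x. \<exists>j\<in>K. \<forall>i\<in>K. j \<sqsubset> i \<longrightarrow> f z i \<sqsubset> f a i"
    proof
      fix a assume "a \<in> s x"
      then have "a \<in> L" "x \<unlhd> a" using s x unfolding family_def by auto
      then show "\<exists>j\<in>K. \<forall>i\<in>K. j \<sqsubset> i \<longrightarrow> f z i \<sqsubset> f a i"
        using f_less z(1) x(2) L.less_le_trans by blast
    qed
    then obtain J where J: "\<forall>a\<in>s x. J a \<in> K \<and> (\<forall>i\<in>K. J a \<sqsubset> i \<longrightarrow> f z i \<sqsubset> f a i)" by metis
    have "|s x| <o |K|" using s x unfolding family_def by auto
    then obtain j1 where j1: "j1 \<in> K" "\<forall>a\<in>s x. J a \<sqsubset> j1" using K_bdd_image[of "s x" J] J by blast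
    obtain j where j: "j \<in> K" "j0 \<sqsubseteq> j" "j1 \<sqsubseteq> j" using j1 z(2) K_upper2[of j0 j1] by blast
    have "g i \<sqsubset> f a i" if "a \<in> s x" "i \<in> K" "j \<sqsubset> i" for a i
    proof -
      have "j0 \<sqsubset> i" "J a \<sqsubset> i" using j j1 that by (meson A.less_trans A.le_less_trans)+
      then show ?thesis using z(3) J that A.less_trans by blast
    qed
    then show ?thesis using j by blast
  qed
  then show ?thesis using z by blast
qed

text \<open>If this failed for cofinally many \<open>j\<close>, a bad value at each of them would
  define a \<open>g\<close> in the product. For large \<open>x\<close>, all of \<open>s x\<close>
  dominates \<open>g\<close> from some coordinate on, including a bad one, which contradicts the
  bound there.\<close>

lemma unb_large_values:
  assumes s: "family s" and W: "unb W"
  shows "\<exists>j0\<in>K. \<forall>j\<in>K. j0 \<sqsubseteq> j \<longrightarrow> (\<forall>\<xi>\<in>Mu j. unb {x\<in>W. \<forall>a\<in>s x. \<xi> \<sqsubset> f a j})"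
proof (rule ccontr)
  assume neg: "\<not> ?thesis"
  define Q where "Q j \<xi> \<longleftrightarrow> \<xi> \<in> Mu j \<and> \<not> unb {x\<in>W. \<forall>a\<in>s x. \<xi> \<sqsubset> f a j}" for j \<xi>
  have often: "\<exists>j\<in>K. j0 \<sqsubseteq> j \<and> (\<exists>\<xi>. Q j \<xi>)" if "j0 \<in> K" for j0
    using neg that unfolding Q_def by blast
  \<comment> \<open>Coordinates without a bad value receive an arbitrary element of
    \<open>Mu j\<close>, so that \<open>g\<close> lies in the product.\<close>
  define g where "g j = (if \<exists>\<xi>. Q j \<xi> then SOME \<xi>. Q j \<xi> else SOME \<xi>. \<xi> \<in> Mu j)" for j
  have gQ: "Q j (g j)" if "\<exists>\<xi>. Q j \<xi>" for j
    unfolding g_def using that someI_ex[OF that] by simp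
  have gMu: "\<forall>i\<in>K. g i \<in> Mu i"
  proof
    fix i assume "i \<in> K"
    then have "\<exists>\<xi>. \<xi> \<in> Mu i" using Mu_infinite by (metis all_not_in_conv finite.emptyI)
    then show "g i \<in> Mu i"
      using gQ[of i] someI_ex[of "\<lambda>\<xi>. \<xi> \<in> Mu i"] unfolding g_def Q_def by (auto split: if_splits)
  qed
  have "\<forall>j\<in>K. \<exists>w\<in>L. (\<exists>\<xi>. Q j \<xi>) \<longrightarrow> (\<forall>x\<in>W. (\<forall>a\<in>s x. g j \<sqsubset> f a j) \<longrightarrow> x \<unlhd> w)"
  proof
    fix j assume "j \<in> K"
    show "\<exists>w\<in>L. (\<exists>\<xi>. Q j \<xi>) \<longrightarrow> (\<forall>x\<in>W. (\<forall>a\<in>s x. g j \<sqsubset> f a j) \<longrightarrow> x \<unlhd> w)"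
    proof (cases "\<exists>\<xi>. Q j \<xi>")
      case True
      then have "\<not> unb {x\<in>W. \<forall>a\<in>s x. g j \<sqsubset> f a j}" using gQ Q_def by blast
      then show ?thesis using W L.not_less unfolding unb_def by blast
    next
      case False
      then show ?thesis using L_bdd[of "{}"] card_of_empty by blast
    qed
  qed
  then obtain w where w: "\<forall>j\<in>K. w j \<in> L \<and> ((\<exists>\<xi>. Q j \<xi>) \<longrightarrow> (\<forall>x\<in>W. (\<forall>a\<in>s x. g j \<sqsubset> f a j) \<longrightarrow> x \<unlhd> w j))"
    by metis
  obtain z0 where z0: "z0 \<in> L" "\<forall>x\<in>L. z0 \<lhd> x \<longrightarrow> (\<exists>j\<in>K. \<forall>a\<in>s x. \<forall>i\<in>K. j \<sqsubset> i \<longrightarrow> g i \<sqsubset> f a i)"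
    using family_eventually_dominates[OF s gMu] by blast
  obtain z1 where z1: "z1 \<in> L" "\<forall>j\<in>K. w j \<lhd> z1" using L_bdd_image[OF K_le_N, of w] w by blast
  obtain x where x: "x \<in> W" "z0 \<lhd> x" "z1 \<lhd> x"
    using unb_above[OF W z0(1)] z1(1) unfolding unb_def by blast
  then have "x \<in> L" using W unfolding unb_def by blast
  then obtain j where j: "j \<in> K" "\<forall>a\<in>s x. \<forall>i\<in>K. j \<sqsubset> i \<longrightarrow> g i \<sqsubset> f a i" using z0 x by blast
  obtain j' where "j' \<in> K" "j \<sqsubset> j'" using K_greater j by blast
  then obtain i where i: "i \<in> K" "j \<sqsubset> i" "\<exists>\<xi>. Q i \<xi>" using often A.less_le_trans by blast
  then have "x \<unlhd> w i" "w i \<lhd> z1" using w z1 j x by blast+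
  with \<open>z1 \<lhd> x\<close> show False by simp
qed

section \<open>Small sets of ordinals reached by descending steps\<close>

text \<open>These injections into \<mu> serve twice: they filter \<open>b\<close> into the small
  sets \<open>dec b i\<close>, and they decode colours in \<open>colour\<close>.\<close>

definition rank :: "'l \<Rightarrow> 'l \<Rightarrow> 'a" where
  "rank b = (SOME g. inj_on g {y\<in>L. y \<lhd> b} \<and> g ` {y\<in>L. y \<lhd> b} \<subseteq> N)"

lemma rank:
  assumes "b \<in> L"
  shows "inj_on (rank b) {y\<in>L. y \<lhd> b}" "\<And>y. y \<in> L \<Longrightarrow> y \<lhd> b \<Longrightarrow> rank b y \<in> N"
proof -
  have "\<exists>g. inj_on g {y\<in>L. y \<lhd> b} \<and> g ` {y\<in>L. y \<lhd> b} \<subseteq> N"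
    using L_seg[OF assms] card_of_ordLeq by blast
  from someI_ex[OF this] show "inj_on (rank b) {y\<in>L. y \<lhd> b}" "\<And>y. y \<in> L \<Longrightarrow> y \<lhd> b \<Longrightarrow> rank b y \<in> N"
    unfolding rank_def by auto
qed

definition dec :: "'l \<Rightarrow> 'a \<Rightarrow> 'l set" where
  "dec b i = {y\<in>L. y \<lhd> b \<and> rank b y \<in> Mu i}"

lemma dec_card: "b \<in> L \<Longrightarrow> |dec b i| \<le>o |Mu i|"
proof -
  assume b: "b \<in> L"
  have "inj_on (rank b) (dec b i)" "rank b ` dec b i \<subseteq> Mu i"
    using inj_on_subset[OF rank(1)[OF b], of "dec b i"] unfolding dec_def by auto
  then show ?thesis using card_of_ordLeq by blast
qed

lemma dec_eventually:
  assumes "b \<in> L" "y \<in> L" "y \<lhd> b"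
  shows "\<exists>i0\<in>K. \<forall>i\<in>K. i0 \<sqsubseteq> i \<longrightarrow> y \<in> dec b i"
proof -
  obtain i0 where i0: "i0 \<in> K" "rank b y \<in> Mu i0" using rank(2) assms Mu_N by blast
  then have "rank b y \<in> Mu i" if "i \<in> K" "i0 \<sqsubseteq> i" for i
    using Mu_mono[of i0 i] that by (cases "i0 = i") (auto simp: A.le_less)
  then show ?thesis using i0 assms unfolding dec_def by blast
qed

text \<open>In terms of cofinalities, the next predicate says that \<^term>\<open>e\<close> is a limit whose cofinality
  exceeds \<^term>\<open>|Mu i|\<close>.\<close>

definition big :: "'a \<Rightarrow> 'l \<Rightarrow> bool" where
  "big i e \<longleftrightarrow> e \<in> L \<and>
     (\<forall>X. X \<subseteq> {y\<in>L. y \<lhd> e} \<and> |X| \<le>o |Mu i| \<longrightarrow> (\<exists>z\<in>L. z \<lhd> e \<and> (\<forall>x\<in>X. x \<lhd> z)))"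

text \<open>For \<open>b\<close> in \<open>L\<close>, a cofinal subset of \<open>b\<close> of size
  at most \<open>|Mu i|\<close>, which exists exactly when \<open>big i b\<close> fails.\<close>

definition ladder :: "'l \<Rightarrow> 'a \<Rightarrow> 'l set" where
  "ladder b i = (if big i b then {} else
     SOME X. X \<subseteq> {y\<in>L. y \<lhd> b} \<and> |X| \<le>o |Mu i| \<and> (\<forall>z\<in>L. z \<lhd> b \<longrightarrow> (\<exists>x\<in>X. z \<unlhd> x)))"

lemma ladder:
  assumes "b \<in> L"
  shows "ladder b i \<subseteq> {y\<in>L. y \<lhd> b}" "|ladder b i| \<le>o |Mu i|"
    "\<And>z. \<not> big i b \<Longrightarrow> z \<in> L \<Longrightarrow> z \<lhd> b \<Longrightarrow> \<exists>x\<in>ladder b i. z \<unlhd> x"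
proof -
  have "ladder b i \<subseteq> {y\<in>L. y \<lhd> b} \<and> |ladder b i| \<le>o |Mu i| \<and>
    (\<not> big i b \<longrightarrow> (\<forall>z\<in>L. z \<lhd> b \<longrightarrow> (\<exists>x\<in>ladder b i. z \<unlhd> x)))"
  proof (cases "big i b")
    case True
    then show ?thesis by (simp add: ladder_def card_of_empty)
  next
    case False
    then have "\<exists>X. X \<subseteq> {y\<in>L. y \<lhd> b} \<and> |X| \<le>o |Mu i| \<and> (\<forall>z\<in>L. z \<lhd> b \<longrightarrow> (\<exists>x\<in>X. z \<unlhd> x))"
      using assms unfolding big_def by (metis L.not_less)
    from someI_ex[OF this] show ?thesis using False unfolding ladder_def by simp
  qed
  then show "ladder b i \<subseteq> {y\<in>L. y \<lhd> b}" "|ladder b i| \<le>o |Mu i|"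
    "\<And>z. \<not> big i b \<Longrightarrow> z \<in> L \<Longrightarrow> z \<lhd> b \<Longrightarrow> \<exists>x\<in>ladder b i. z \<unlhd> x" by blast+
qed

text \<open>A pair is one step down from \<open>b\<close> to \<open>y\<close>. The last alternative
  leads to the maximum of \<open>D\<close> below \<open>b\<close>, if there is one; only here does
  \<open>D\<close> enter.\<close>

definition step :: "'l set \<Rightarrow> 'a \<Rightarrow> ('l \<times> 'l) set" where
  "step D i = {(y, b). b \<in> L \<and>
     (y \<in> dec b i \<or> y \<in> ladder b i \<or> y \<in> D \<inter> L \<and> y \<lhd> b \<and> (\<forall>z\<in>D. z \<lhd> b \<longrightarrow> z \<unlhd> y))}"

text \<open>The closure makes these sets transitive by construction, so that a guessed point of
  \<open>reach D \<delta> i\<close> is passed on to every \<open>b\<close> that reaches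
  \<open>\<delta>\<close>.\<close>

definition reach :: "'l set \<Rightarrow> 'l \<Rightarrow> 'a \<Rightarrow> 'l set" where
  "reach D b i = {y. (y, b) \<in> (step D i)\<^sup>*}"

lemma stepD:
  assumes "(y, b) \<in> step D i" shows "y \<in> L" "b \<in> L" "y \<lhd> b"
  using assms ladder(1)[of b i] unfolding step_def dec_def by auto

lemma reach_self: "b \<in> reach D b i"
  unfolding reach_def by simp

lemma reach_trans: "y \<in> reach D b i \<Longrightarrow> reach D y i \<subseteq> reach D b i"
  unfolding reach_def by (auto intro: rtrancl_trans)

lemma reach_step: "y \<in> reach D b i \<Longrightarrow> (z, y) \<in> step D i \<Longrightarrow> z \<in> reach D b i"
  unfolding reach_def by (auto intro: converse_rtrancl_into_rtrancl)

lemma reach_le: "b \<in> L \<Longrightarrow> y \<in> reach D b i \<Longrightarrow> y \<in> L \<and> y \<unlhd> b"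
proof -
  assume b: "b \<in> L" and "y \<in> reach D b i"
  then have "(y, b) \<in> (step D i)\<^sup>*" unfolding reach_def by simp
  then show ?thesis
  proof (induction rule: converse_rtrancl_induct)
    case base
    then show ?case using b by simp
  next
    case (step y z)
    then show ?case using stepD[OF step(1)] by auto
  qed
qed

lemma reach_unfold: "reach D b i = {b} \<union> (\<Union>y\<in>{y. (y, b) \<in> step D i}. reach D y i)"
  unfolding reach_def by (auto elim: rtranclE intro: rtrancl_into_rtrancl)

lemma step_card:
  assumes "b \<in> L" "i \<in> K" shows "|{y. (y, b) \<in> step D i}| \<le>o |Mu i|"
proof -
  let ?P = "{y. y \<in> D \<inter> L \<and> y \<lhd> b \<and> (\<forall>z\<in>D. z \<lhd> b \<longrightarrow> z \<unlhd> y)}"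
  have inf: "infinite (Mu i)" using assms Mu_infinite by blast
  have "x = y" if "x \<in> ?P" "y \<in> ?P" for x y
    using that by (auto intro: L.order_antisym)
  then obtain y where "?P \<subseteq> {y}" by blast
  then have P: "|?P| \<le>o |Mu i|"
    by (rule ordLeq_transitive[OF card_of_mono1 card_of_singleton_le[OF inf]])
  have "{y. (y, b) \<in> step D i} = dec b i \<union> (ladder b i \<union> ?P)"
    unfolding step_def using assms by auto
  then show ?thesis
    using card_of_Un_le[OF inf dec_card[OF assms(1)] card_of_Un_le[OF inf ladder(2)[OF assms(1)] P]]
    by simp
qed

text \<open>Steps strictly descend, so induction on \<open>b\<close> applies: a nontrivial path from
  \<open>b\<close> begins with one of at most \<open>|Mu i|\<close> steps.\<close>

lemma reach_card: "b \<in> L \<Longrightarrow> i \<in> K \<Longrightarrow> |reach D b i| \<le>o |Mu i|"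
proof (induction b rule: L.less_induct)
  case (less b)
  have inf: "infinite (Mu i)" by (rule Mu_infinite[OF less.prems(2)])
  have "\<forall>y\<in>{y. (y, b) \<in> step D i}. |reach D y i| \<le>o |Mu i|"
    by (auto intro!: less.IH less.prems dest: stepD)
  then have "|\<Union>y\<in>{y. (y, b) \<in> step D i}. reach D y i| \<le>o |Mu i|"
    by (rule card_of_UNION_ordLeq_infinite[OF inf step_card[OF less.prems]])
  then show ?case
    unfolding reach_unfold[of D b i] by (rule card_of_Un_le[OF inf card_of_singleton_le[OF inf]])
qed

lemma reach_eventually:
  assumes "b \<in> L" "y \<in> L" "y \<lhd> b"
  shows "\<exists>i0\<in>K. \<forall>i\<in>K. i0 \<sqsubseteq> i \<longrightarrow> y \<in> reach D b i"
proof -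
  have "y \<in> reach D b i" if "y \<in> dec b i" for i
    using reach_step[OF reach_self, of y b D i] that assms unfolding step_def by blast
  then show ?thesis using dec_eventually[OF assms] by blast
qed

section \<open>Club guessing\<close>

text \<open>Functions stand in for clubs: if \<open>p\<close> maps \<open>L\<close> into itself, the
  points closed under \<open>p\<close> form a club in \<open>L\<close>.\<close>

definition closed_pt :: "('l \<Rightarrow> 'l) \<Rightarrow> 'l \<Rightarrow> bool" where
  "closed_pt p e \<longleftrightarrow> (\<forall>x\<in>L. x \<lhd> e \<longrightarrow> p x \<lhd> e)"

text \<open>Closing off: \<open>q\<close> outgrows all \<open>P z\<close> on initial segments, and
  the supremum of \<omega> iterates of \<open>q\<close> is closed under every
  \<open>P z\<close>.\<close>

lemma closed_pts_unb:
  assumes "|Z| \<le>o |N|" and P: "\<And>z x. z \<in> Z \<Longrightarrow> x \<in> L \<Longrightarrow> P z x \<in> L"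
  shows "unb {e\<in>L. \<forall>z\<in>Z. closed_pt (P z) e}"
  unfolding unb_def
proof (intro conjI ballI)
  fix w assume w: "w \<in> L"
  have "\<forall>x\<in>L. \<exists>u\<in>L. x \<lhd> u \<and> (\<forall>z\<in>Z. \<forall>y\<in>L. y \<unlhd> x \<longrightarrow> P z y \<lhd> u)"
  proof
    fix x assume x: "x \<in> L"
    have "{y\<in>L. y \<unlhd> x} = {x} \<union> {y\<in>L. y \<lhd> x}" using x by auto
    then have Y: "|{y\<in>L. y \<unlhd> x}| \<le>o |N|"
      using card_of_Un_le[OF N_infinite card_of_singleton_le[OF N_infinite] L_seg[OF x]] by simp
    have "\<forall>z\<in>Z. \<exists>u\<in>L. \<forall>y\<in>{y\<in>L. y \<unlhd> x}. P z y \<lhd> u"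
      using P by (intro ballI L_bdd_image[OF Y]) auto
    then obtain u where u: "\<forall>z\<in>Z. u z \<in> L \<and> (\<forall>y\<in>{y\<in>L. y \<unlhd> x}. P z y \<lhd> u z)" by metis
    obtain v where v: "v \<in> L" "\<forall>z\<in>Z. u z \<lhd> v" using L_bdd_image[OF assms(1), of u] u by blast
    obtain x' where x': "x' \<in> L" "x \<lhd> x'" using L_greater[OF x] by blast
    obtain v' where "v' \<in> L" "v \<unlhd> v'" "x' \<unlhd> v'" using L_upper2[OF v(1) x'(1)] by blast
    moreover have "P z y \<lhd> v'" if "z \<in> Z" "y \<in> L" "y \<unlhd> x" for z y
    proof -
      have "P z y \<lhd> u z" "u z \<lhd> v" using u v that by blast+
      with \<open>v \<unlhd> v'\<close> show ?thesis by order
    qed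
    ultimately show "\<exists>u\<in>L. x \<lhd> u \<and> (\<forall>z\<in>Z. \<forall>y\<in>L. y \<unlhd> x \<longrightarrow> P z y \<lhd> u)"
      using x' by (intro bexI[of _ v']) auto
  qed
  then obtain q where q: "\<forall>x\<in>L. q x \<in> L \<and> x \<lhd> q x \<and> (\<forall>z\<in>Z. \<forall>y\<in>L. y \<unlhd> x \<longrightarrow> P z y \<lhd> q x)" by metis
  define c where "c n = (q ^^ n) w" for n
  have cL: "c n \<in> L" for n unfolding c_def by (induction n) (use w q in auto)
  have cS: "c n \<lhd> c (Suc n)" "\<And>z y. z \<in> Z \<Longrightarrow> y \<in> L \<Longrightarrow> y \<unlhd> c n \<Longrightarrow> P z y \<lhd> c (Suc n)" for n
    using q cL[of n] unfolding c_def by auto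
  have "|UNIV :: nat set| \<le>o |N|"
    using N_infinite infinite_iff_card_of_nat[of N] by blast
  then obtain u where u: "u \<in> L" "\<forall>n. c n \<lhd> u" using L_bdd_image[of UNIV c] cL by blast
  define e where "e = L.Least (\<lambda>e. e \<in> L \<and> (\<forall>n. c n \<unlhd> e))"
  have e: "e \<in> L" "\<forall>n. c n \<unlhd> e"
    using L.LeastI[of "\<lambda>e. e \<in> L \<and> (\<forall>n. c n \<unlhd> e)" u] u L.less_imp_le unfolding e_def by blast+
  have below: "\<exists>n. x \<unlhd> c n" if "x \<in> L" "x \<lhd> e" for x
    using L.not_less_Least[of x "\<lambda>e. e \<in> L \<and> (\<forall>n. c n \<unlhd> e)"] that L.linear unfolding e_def by blast
  have "closed_pt (P z) e" if z: "z \<in> Z" for z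
    unfolding closed_pt_def
  proof (intro ballI impI)
    fix x assume x: "x \<in> L" "x \<lhd> e"
    then obtain n where "x \<unlhd> c n" using below by blast
    then have "P z x \<lhd> c (Suc n)" using cS z x by blast
    then show "P z x \<lhd> e" using e(2) L.less_le_trans by blast
  qed
  moreover have "w \<lhd> e" using L.less_le_trans[OF cS(1)[of 0] spec[OF e(2)]] by (simp add: c_def)
  ultimately show "\<exists>x\<in>{e\<in>L. \<forall>z\<in>Z. closed_pt (P z) e}. w \<lhd> x" using e by blast
qed auto

text \<open>By regularity of \<lambda> an unbounded set has more than \<open>|N|\<close> elements.
  Already \<open>|N|\<close> of them, which is more than any \<open>|Mu i|\<close>, have a common
  bound.\<close>

lemma unb_initial_card:
  assumes "unb X"
  shows "\<exists>\<delta>\<in>L. \<forall>i\<in>K. \<not> |{x\<in>X. x \<lhd> \<delta>}| \<le>o |Mu i|"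
proof -
  have "\<not> |X| \<le>o |N|"
  proof
    assume "|X| \<le>o |N|"
    then obtain z where z: "z \<in> L" "\<forall>x\<in>X. x \<lhd> z" using L_bdd[of X] assms unfolding unb_def by blast
    then obtain x where "x \<in> X" "z \<lhd> x" using assms unfolding unb_def by blast
    with z(2) have "x \<lhd> z" by blast
    with \<open>z \<lhd> x\<close> show False by simp
  qed
  then have "|N| <o |X|" using card_of_ordLeq[of X N] card_of_ordLess[of X N] by simp
  then have "|N| \<le>o |X|" by (rule ordLess_imp_ordLeq)
  then obtain g where g: "inj_on g N" "g ` N \<subseteq> X" using card_of_ordLeq[of N X] by auto
  then have "\<And>n. n \<in> N \<Longrightarrow> g n \<in> L" using assms unfolding unb_def by blast
  then obtain \<delta> where \<delta>: "\<delta> \<in> L" "\<forall>n\<in>N. g n \<lhd> \<delta>"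
    using L_bdd_image[of N g] ordLeq_reflexive[OF card_of_Well_order[of N]] by blast
  then have "g ` N \<subseteq> {x\<in>X. x \<lhd> \<delta>}" using g by blast
  then have N: "|N| \<le>o |{x\<in>X. x \<lhd> \<delta>}|" using g(1) card_of_ordLeq[of N "{x\<in>X. x \<lhd> \<delta>}"] by blast
  have "\<not> |{x\<in>X. x \<lhd> \<delta>}| \<le>o |Mu i|" if i: "i \<in> K" for i
  proof
    assume "|{x\<in>X. x \<lhd> \<delta>}| \<le>o |Mu i|"
    with N have 1: "|N| \<le>o |Mu i|" by (rule ordLeq_transitive)
    obtain j where j: "j \<in> K" "i \<sqsubset> j" using K_greater[OF i] by blast
    have "|Mu i| <o |N|" using ordLess_ordLeq_trans[OF Mu_less[OF i j] Mu_le_N[OF j(1)]] .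
    with 1 show False using not_ordLeq_ordLess[of "|N|"] by blast
  qed
  then show ?thesis using \<delta> by blast
qed

text \<open>Relative to a decreasing sequence of closed sets, the least point above \<^term>\<open>x\<close> that is
  eventually reachable must lie in all the sets and have large cofinality: otherwise one more step
  down would give a smaller such point, since the maxima of \<^term>\<open>D \<zeta>\<close> below a fixed point
  decrease and hence stabilise.\<close>

lemma reach_stabilises:
  assumes i: "i \<in> K" and Z: "Z \<noteq> {}" "|Z| \<le>o |Mu i|"
    and D: "\<And>\<zeta>. D \<zeta> \<subseteq> L" "\<And>\<zeta> \<xi>. \<zeta> \<sqsubseteq> \<xi> \<Longrightarrow> D \<xi> \<subseteq> D \<zeta>"
    and D_max: "\<And>\<zeta> x \<gamma>. \<gamma> \<in> L \<Longrightarrow> \<gamma> \<notin> D \<zeta> \<Longrightarrow> x \<in> D \<zeta> \<Longrightarrow> x \<lhd> \<gamma> \<Longrightarrow>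
      \<exists>m\<in>D \<zeta>. m \<lhd> \<gamma> \<and> (\<forall>z\<in>D \<zeta>. z \<lhd> \<gamma> \<longrightarrow> z \<unlhd> m)"
    and \<delta>: "\<delta> \<in> L" "\<not> |{x\<in>\<Inter>(D ` Z). x \<lhd> \<delta>}| \<le>o |Mu i|"
  shows "\<exists>\<gamma>. big i \<gamma> \<and> (\<forall>\<zeta>\<in>Z. \<gamma> \<in> D \<zeta>) \<and> (\<exists>\<zeta>0\<in>Z. \<forall>\<zeta>\<in>Z. \<zeta>0 \<sqsubseteq> \<zeta> \<longrightarrow> \<gamma> \<in> reach (D \<zeta>) \<delta> i)"
proof -
  \<comment> \<open>All the reachable sets together have at most \<open>|Mu i|\<close> points, too
    few to cover the intersection below \<open>\<delta>\<close>; \<open>x\<close> is a point that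
    they all miss.\<close>
  have "|\<Union>\<zeta>\<in>Z. reach (D \<zeta>) \<delta> i| \<le>o |Mu i|"
    by (rule card_of_UNION_ordLeq_infinite[OF Mu_infinite[OF i] Z(2)]) (simp add: reach_card[OF \<delta>(1) i])
  then have "\<not> {x\<in>\<Inter>(D ` Z). x \<lhd> \<delta>} \<subseteq> (\<Union>\<zeta>\<in>Z. reach (D \<zeta>) \<delta> i)"
    using \<delta>(2) ordLeq_transitive[OF card_of_mono1] by blast
  then obtain x where x: "\<forall>\<zeta>\<in>Z. x \<in> D \<zeta>" "x \<lhd> \<delta>" "\<forall>\<zeta>\<in>Z. x \<notin> reach (D \<zeta>) \<delta> i" by blast
  have xL: "x \<in> L" using x(1) Z(1) D(1) by blast
  define G where "G \<gamma> \<longleftrightarrow> x \<lhd> \<gamma> \<and> (\<exists>\<zeta>0\<in>Z. \<forall>\<zeta>\<in>Z. \<zeta>0 \<sqsubseteq> \<zeta> \<longrightarrow> \<gamma> \<in> reach (D \<zeta>) \<delta> i)" for \<gamma>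
  have "G \<delta>" using x(2) Z(1) reach_self unfolding G_def by blast
  define \<gamma> where "\<gamma> = L.Least G"
  have G\<gamma>: "G \<gamma>" using L.LeastI[of G, OF \<open>G \<delta>\<close>] unfolding \<gamma>_def .
  have min: "\<not> G y" if "y \<lhd> \<gamma>" for y using L.not_less_Least that unfolding \<gamma>_def by blast
  obtain \<zeta>0 where \<zeta>0: "\<zeta>0 \<in> Z" "\<forall>\<zeta>\<in>Z. \<zeta>0 \<sqsubseteq> \<zeta> \<longrightarrow> \<gamma> \<in> reach (D \<zeta>) \<delta> i" and x\<gamma>: "x \<lhd> \<gamma>"
    using G\<gamma> unfolding G_def by blast
  have \<gamma>L: "\<gamma> \<in> L" using \<zeta>0 reach_le[OF \<delta>(1)] A.order_refl by blast
  \<comment> \<open>A step from \<open>\<gamma>\<close> to \<open>y\<close> that is available at all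
    late indices would make \<open>y\<close> a smaller candidate than \<open>\<gamma>\<close>;
    \<open>y\<close> cannot be \<open>x\<close>, which is never reached.\<close>
  have no_step: False
    if y: "x \<unlhd> y" and \<zeta>1: "\<zeta>1 \<in> Z" and st: "\<And>\<zeta>. \<zeta> \<in> Z \<Longrightarrow> \<zeta>1 \<sqsubseteq> \<zeta> \<Longrightarrow> (y, \<gamma>) \<in> step (D \<zeta>) i" for y \<zeta>1
  proof -
    obtain \<zeta>2 where \<zeta>2: "\<zeta>2 \<in> Z" "\<zeta>0 \<sqsubseteq> \<zeta>2" "\<zeta>1 \<sqsubseteq> \<zeta>2" using \<zeta>0(1) \<zeta>1 by (metis A.linear A.order_refl)
    have r: "y \<in> reach (D \<zeta>) \<delta> i" if "\<zeta> \<in> Z" "\<zeta>2 \<sqsubseteq> \<zeta>" for \<zeta>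
    proof -
      have "\<zeta>0 \<sqsubseteq> \<zeta>" "\<zeta>1 \<sqsubseteq> \<zeta>" using \<zeta>2 that by order+
      then show ?thesis using \<zeta>0(2) st that reach_step by blast
    qed
    then have "x \<noteq> y" using x(3) \<zeta>2(1) by auto
    then have "x \<lhd> y" using y by order
    then have "G y" using r \<zeta>2(1) unfolding G_def by blast
    moreover have "y \<lhd> \<gamma>" using stepD(3)[OF st[OF \<zeta>1]] by simp
    ultimately show False using min by blast
  qed
  have "big i \<gamma>"
  proof (rule ccontr)
    assume "\<not> big i \<gamma>"
    then obtain y where y: "y \<in> ladder \<gamma> i" "x \<unlhd> y" using ladder(3)[OF \<gamma>L] xL x\<gamma> by blast
    then have "(y, \<gamma>) \<in> step (D \<zeta>) i" for \<zeta> using \<gamma>L unfolding step_def by blast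
    with no_step[OF y(2) \<zeta>0(1)] show False by blast
  qed
  moreover have "\<gamma> \<in> D \<zeta>" if "\<zeta> \<in> Z" for \<zeta>
  proof (rule ccontr)
    assume \<gamma>D: "\<gamma> \<notin> D \<zeta>"
    define R where "R m \<longleftrightarrow> (\<exists>\<xi>\<in>Z. \<zeta> \<sqsubseteq> \<xi> \<and> m \<in> D \<xi> \<and> m \<lhd> \<gamma> \<and> (\<forall>z\<in>D \<xi>. z \<lhd> \<gamma> \<longrightarrow> z \<unlhd> m))" for m
    have mx: "\<exists>m\<in>D \<xi>. m \<lhd> \<gamma> \<and> (\<forall>z\<in>D \<xi>. z \<lhd> \<gamma> \<longrightarrow> z \<unlhd> m)" if "\<xi> \<in> Z" "\<zeta> \<sqsubseteq> \<xi>" for \<xi>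
      using D_max[OF \<gamma>L _ _ x\<gamma>, of \<xi>] \<gamma>D D(2)[OF that(2)] x(1) that by blast
    then have "\<exists>m. R m" using \<open>\<zeta> \<in> Z\<close> A.order_refl unfolding R_def by blast
    \<comment> \<open>The least of the maxima is attained at some \<open>\<xi>\<close> and kept from
      there on, so it is a step at all late indices.\<close>
    then have "R (L.Least R)" by (rule L.LeastI_ex)
    then obtain m \<xi> where m: "m = L.Least R" "\<xi> \<in> Z" "\<zeta> \<sqsubseteq> \<xi>" "m \<in> D \<xi>" "m \<lhd> \<gamma>"
      "\<forall>z\<in>D \<xi>. z \<lhd> \<gamma> \<longrightarrow> z \<unlhd> m" unfolding R_def by blast
    have "(m, \<gamma>) \<in> step (D \<upsilon>) i" if \<upsilon>: "\<upsilon> \<in> Z" "\<xi> \<sqsubseteq> \<upsilon>" for \<upsilon>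
    proof -
      have "\<zeta> \<sqsubseteq> \<upsilon>" using m(3) \<upsilon>(2) by order
      then obtain m' where m': "m' \<in> D \<upsilon>" "m' \<lhd> \<gamma>" "\<forall>z\<in>D \<upsilon>. z \<lhd> \<gamma> \<longrightarrow> z \<unlhd> m'" using mx[OF \<upsilon>(1)] by blast
      then have "R m'" using \<upsilon>(1) \<open>\<zeta> \<sqsubseteq> \<upsilon>\<close> unfolding R_def by blast
      then have "m \<unlhd> m'" unfolding m(1) by (rule L.Least_le)
      moreover have "m' \<unlhd> m" using m'(1,2) m(6) D(2)[OF \<upsilon>(2)] by blast
      ultimately have "m = m'" by order
      then show ?thesis using m' \<gamma>L D(1) unfolding step_def by blast
    qed
    moreover have "x \<unlhd> m" using m(2,6) x(1) x\<gamma> by blast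
    ultimately show False using no_step m(2) by blast
  qed
  ultimately show ?thesis using \<zeta>0 by blast
qed

text \<open>If some \<open>p\<close> refutes each \<open>D\<close>, keep shrinking:
  \<open>D \<zeta>\<close> consists of the points closed under the refutations of all earlier sets,
  for \<open>\<zeta>\<close> below a regular cardinal above \<kappa>. By
  \<open>reach_stabilises\<close> a big point lies in all these sets and is reachable at late
  indices. Lying in all of them it is closed under every refutation, among them that of a set which
  reaches it.\<close>

lemma guessing:
  "\<exists>D. \<forall>p. (\<forall>x\<in>L. p x \<in> L) \<longrightarrow>
     (\<exists>\<delta>\<in>L. \<forall>i0\<in>K. \<exists>i\<in>K. i0 \<sqsubseteq> i \<and> (\<exists>e\<in>reach D \<delta> i. big i e \<and> closed_pt p e))"
proof (rule ccontr)
  assume neg: "\<not> ?thesis"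
  have "\<forall>D. \<exists>p. (\<forall>x\<in>L. p x \<in> L) \<and>
     (\<forall>\<delta>\<in>L. \<exists>i0\<in>K. \<forall>i\<in>K. i0 \<sqsubseteq> i \<longrightarrow> (\<forall>e\<in>reach D \<delta> i. \<not> (big i e \<and> closed_pt p e)))"
  proof
    fix D
    let ?Q = "\<lambda>p. \<exists>\<delta>\<in>L. \<forall>i0\<in>K. \<exists>i\<in>K. i0 \<sqsubseteq> i \<and> (\<exists>e\<in>reach D \<delta> i. big i e \<and> closed_pt p e)"
    have "\<not> (\<forall>p. (\<forall>x\<in>L. p x \<in> L) \<longrightarrow> ?Q p)" using neg by (rule contrapos_nn) (rule exI)
    then obtain p where p: "\<forall>x\<in>L. p x \<in> L" "\<not> ?Q p" by (auto simp only: not_all not_imp)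
    from p(2) have "\<forall>\<delta>\<in>L. \<exists>i0\<in>K. \<forall>i\<in>K. i0 \<sqsubseteq> i \<longrightarrow> (\<forall>e\<in>reach D \<delta> i. \<not> (big i e \<and> closed_pt p e))"
      by (simp only: bex_simps ball_simps de_Morgan_conj not_not imp_conv_disj) 
    with p(1) show "\<exists>p. (\<forall>x\<in>L. p x \<in> L) \<and>
     (\<forall>\<delta>\<in>L. \<exists>i0\<in>K. \<forall>i\<in>K. i0 \<sqsubseteq> i \<longrightarrow> (\<forall>e\<in>reach D \<delta> i. \<not> (big i e \<and> closed_pt p e)))"
      by (intro exI[of _ p] conjI)
  qed
  then obtain P where P: "\<And>D x. x \<in> L \<Longrightarrow> P D x \<in> L"
    "\<And>D \<delta>. \<delta> \<in> L \<Longrightarrow> \<exists>i0\<in>K. \<forall>i\<in>K. i0 \<sqsubseteq> i \<longrightarrow> (\<forall>e\<in>reach D \<delta> i. \<not> (big i e \<and> closed_pt (P D) e))"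
    by metis
  obtain i0 where i0: "i0 \<in> K" using K_nonempty by blast
  define Z where "Z = Mu i0"
  define r where "r = {(\<xi>, \<zeta>). \<xi> \<sqsubset> \<zeta>}"
  have wf: "wf r" unfolding r_def by (rule A.wf)
  \<comment> \<open>The body of a well-founded recursion; \<open>F\<close> stands for the sequence
    constructed so far.\<close>
  define H where "H F \<zeta> = {e\<in>L. \<forall>\<xi>\<in>Z. \<xi> \<sqsubset> \<zeta> \<longrightarrow> closed_pt (P (F \<xi>)) e}" for F :: "'a \<Rightarrow> 'l set" and \<zeta>
  define D where "D = wfrec r H"
  have D: "D \<zeta> = {e\<in>L. \<forall>\<xi>\<in>Z. \<xi> \<sqsubset> \<zeta> \<longrightarrow> closed_pt (P (D \<xi>)) e}" for \<zeta>
    unfolding D_def by (subst wfrec[OF wf]) (auto simp: H_def cut_def r_def)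
  have ZN: "|Z| \<le>o |N|" unfolding Z_def using Mu_le_N[OF i0] .
  \<comment> \<open>\<open>Mu i0\<close> has no largest element, so every refutation is taken into
    account at some later index.\<close>
  have int: "\<Inter>(D ` Z) = {e\<in>L. \<forall>\<xi>\<in>Z. closed_pt (P (D \<xi>)) e}"
  proof -
    have "Z \<noteq> {}" unfolding Z_def using Mu_infinite[OF i0] by auto
    moreover have "\<exists>\<zeta>\<in>Z. \<xi> \<sqsubset> \<zeta>" if "\<xi> \<in> Z" for \<xi> using that Mu_greater[OF i0] unfolding Z_def by blast
    moreover have "e \<in> D \<zeta> \<longleftrightarrow> e \<in> L \<and> (\<forall>\<xi>\<in>Z. \<xi> \<sqsubset> \<zeta> \<longrightarrow> closed_pt (P (D \<xi>)) e)" for e \<zeta>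
      by (subst D) simp
    ultimately show ?thesis by blast
  qed
  have "unb (\<Inter>(D ` Z))" unfolding int using closed_pts_unb[OF ZN, of "\<lambda>\<xi>. P (D \<xi>)"] P(1) by blast
  then obtain \<delta> where \<delta>: "\<delta> \<in> L" "\<forall>i\<in>K. \<not> |{x\<in>\<Inter>(D ` Z). x \<lhd> \<delta>}| \<le>o |Mu i|"
    using unb_initial_card by blast
  define bad where "bad \<zeta> j \<longleftrightarrow> j \<in> K \<and>
    (\<forall>i\<in>K. j \<sqsubseteq> i \<longrightarrow> (\<forall>e\<in>reach (D \<zeta>) \<delta> i. \<not> (big i e \<and> closed_pt (P (D \<zeta>)) e)))" for \<zeta> j
  have "\<forall>\<zeta>. \<exists>j. bad \<zeta> j" unfolding bad_def using P(2)[OF \<delta>(1)] by (simp add: Bex_def)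
  then obtain I where "\<forall>\<zeta>. bad \<zeta> (I \<zeta>)" using choice[of bad] by blast
  then have I: "\<And>\<zeta>. I \<zeta> \<in> K"
    "\<And>\<zeta> i e. i \<in> K \<Longrightarrow> I \<zeta> \<sqsubseteq> i \<Longrightarrow> e \<in> reach (D \<zeta>) \<delta> i \<Longrightarrow> \<not> (big i e \<and> closed_pt (P (D \<zeta>)) e)"
    unfolding bad_def by blast+
  \<comment> \<open>One \<open>i\<close> bounds \<open>I \<zeta>\<close> for cofinally many
    \<open>\<zeta>\<close>. Otherwise each \<open>i\<close> beyond \<open>i0\<close> is exceeded
    from some \<open>z i\<close> on. As \<kappa> is smaller than the regular \<open>Mu i0\<close>,
    one \<open>\<zeta>\<close> lies beyond all \<open>z i\<close>, and then \<open>I \<zeta>\<close>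
    would exceed every such \<open>i\<close>.\<close>
  have "\<exists>i\<in>K. i0 \<sqsubseteq> i \<and> (\<forall>\<zeta>0\<in>Z. \<exists>\<zeta>\<in>Z. \<zeta>0 \<sqsubseteq> \<zeta> \<and> I \<zeta> \<sqsubseteq> i)"
  proof (rule ccontr)
    assume neg: "\<not> ?thesis"
    have "\<forall>i\<in>K. \<exists>z\<in>Z. i0 \<sqsubseteq> i \<longrightarrow> (\<forall>\<zeta>\<in>Z. z \<sqsubseteq> \<zeta> \<longrightarrow> i \<sqsubset> I \<zeta>)"
    proof
      fix i assume "i \<in> K"
      then show "\<exists>z\<in>Z. i0 \<sqsubseteq> i \<longrightarrow> (\<forall>\<zeta>\<in>Z. z \<sqsubseteq> \<zeta> \<longrightarrow> i \<sqsubset> I \<zeta>)"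
        using neg Mu_infinite[OF i0] unfolding Z_def A.not_le[symmetric] by (metis finite.emptyI all_not_in_conv)
    qed
    then obtain z where z: "\<forall>i\<in>K. z i \<in> Z \<and> (i0 \<sqsubseteq> i \<longrightarrow> (\<forall>\<zeta>\<in>Z. z i \<sqsubseteq> \<zeta> \<longrightarrow> i \<sqsubset> I \<zeta>))" by metis
    then obtain \<zeta> where \<zeta>: "\<zeta> \<in> Z" "\<forall>i\<in>K. z i \<sqsubset> \<zeta>"
      using Mu_bdd_image[OF i0 K_Mu[OF i0], of z] unfolding Z_def by blast
    obtain i where i: "i \<in> K" "i0 \<sqsubseteq> i" "I \<zeta> \<sqsubseteq> i" using K_upper2[OF i0 I(1)] by blast
    then have "z i \<sqsubseteq> \<zeta>" using \<zeta>(2) A.less_imp_le by blast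
    then have "i \<sqsubset> I \<zeta>" using z i(1,2) \<zeta>(1) by blast
    with i(3) show False by simp
  qed
  then obtain i where i: "i \<in> K" "i0 \<sqsubseteq> i" "\<forall>\<zeta>0\<in>Z. \<exists>\<zeta>\<in>Z. \<zeta>0 \<sqsubseteq> \<zeta> \<and> I \<zeta> \<sqsubseteq> i" by blast
  \<comment> \<open>As \<open>\<gamma>\<close> is not closed, some \<open>y\<close> below it is sent
    to \<open>\<gamma>\<close> or beyond, and this \<open>y\<close> bounds the points of
    \<open>D \<zeta>\<close> below \<open>\<gamma>\<close>. Their supremum \<open>u\<close> is
    closed again, hence is the maximum.\<close>
  have D_max: "\<exists>m\<in>D \<zeta>. m \<lhd> \<gamma> \<and> (\<forall>z\<in>D \<zeta>. z \<lhd> \<gamma> \<longrightarrow> z \<unlhd> m)"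
    if \<gamma>: "\<gamma> \<in> L" "\<gamma> \<notin> D \<zeta>" and x: "x \<in> D \<zeta>" "x \<lhd> \<gamma>" for \<zeta> x \<gamma>
  proof -
    obtain \<xi> y where y: "\<xi> \<in> Z" "\<xi> \<sqsubset> \<zeta>" "y \<in> L" "y \<lhd> \<gamma>" "\<not> P (D \<xi>) y \<lhd> \<gamma>"
      using \<gamma> unfolding D[of \<zeta>] closed_pt_def by blast
    have ub: "z \<unlhd> y" if z: "z \<in> D \<zeta>" "z \<lhd> \<gamma>" for z
    proof (rule ccontr)
      assume "\<not> z \<unlhd> y"
      then have "y \<lhd> z" by simp
      then have "P (D \<xi>) y \<lhd> z" using z(1) y unfolding D[of \<zeta>] closed_pt_def by blast
      then show False using z(2) y(5) by order
    qed
    define Q where "Q u \<longleftrightarrow> u \<in> L \<and> (\<forall>z\<in>D \<zeta>. z \<lhd> \<gamma> \<longrightarrow> z \<unlhd> u)" for u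
    have "Q y" using ub y(3) unfolding Q_def by blast
    define u where "u = L.Least Q"
    have "Q u" "u \<unlhd> y" unfolding u_def using L.LeastI[of Q, OF \<open>Q y\<close>] L.Least_le[of Q, OF \<open>Q y\<close>] .
    have "closed_pt (P (D \<upsilon>)) u" if \<upsilon>: "\<upsilon> \<in> Z" "\<upsilon> \<sqsubset> \<zeta>" for \<upsilon>
      unfolding closed_pt_def
    proof (intro ballI impI)
      fix v assume v: "v \<in> L" "v \<lhd> u"
      then have "\<not> Q v" unfolding u_def using L.not_less_Least by blast
      then obtain z where z: "z \<in> D \<zeta>" "z \<lhd> \<gamma>" "v \<lhd> z" using v(1) unfolding Q_def by auto
      then have "P (D \<upsilon>) v \<lhd> z" using \<upsilon> v(1) unfolding D[of \<zeta>] closed_pt_def by blast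
      moreover have "z \<unlhd> u" using z \<open>Q u\<close> unfolding Q_def by blast
      ultimately show "P (D \<upsilon>) v \<lhd> u" by order
    qed
    then have "u \<in> D \<zeta>" using \<open>Q u\<close> unfolding D[of \<zeta>] Q_def by blast
    moreover have "u \<lhd> \<gamma>" using \<open>u \<unlhd> y\<close> y(4) by order
    ultimately show ?thesis using \<open>Q u\<close> unfolding Q_def by blast
  qed
  have D_sub: "\<And>\<zeta>. D \<zeta> \<subseteq> L" by (subst D) blast
  have D_anti: "\<And>\<zeta> \<xi>. \<zeta> \<sqsubseteq> \<xi> \<Longrightarrow> D \<xi> \<subseteq> D \<zeta>"
  proof -
    fix \<zeta> \<xi> assume "\<zeta> \<sqsubseteq> \<xi>"
    then have "\<And>\<upsilon>. \<upsilon> \<sqsubset> \<zeta> \<Longrightarrow> \<upsilon> \<sqsubset> \<xi>" by order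
    then show "D \<xi> \<subseteq> D \<zeta>" unfolding D[of \<zeta>] D[of \<xi>] by blast
  qed
  have Z_ne: "Z \<noteq> {}" unfolding Z_def using Mu_infinite[OF i0] by auto
  have Z_le: "|Z| \<le>o |Mu i|" unfolding Z_def using Mu_le[OF i0 i(1,2)] .
  have "\<exists>\<gamma>. big i \<gamma> \<and> (\<forall>\<zeta>\<in>Z. \<gamma> \<in> D \<zeta>) \<and> (\<exists>\<zeta>0\<in>Z. \<forall>\<zeta>\<in>Z. \<zeta>0 \<sqsubseteq> \<zeta> \<longrightarrow> \<gamma> \<in> reach (D \<zeta>) \<delta> i)"
    by (rule reach_stabilises[where D = D, OF i(1) Z_ne Z_le])
      (fact D_sub D_anti D_max \<delta>(1) \<delta>(2)[rule_format, OF i(1)])+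
  then obtain \<gamma> \<zeta>0 where \<gamma>: "big i \<gamma>" "\<forall>\<zeta>\<in>Z. \<gamma> \<in> D \<zeta>" "\<zeta>0 \<in> Z"
    "\<forall>\<zeta>\<in>Z. \<zeta>0 \<sqsubseteq> \<zeta> \<longrightarrow> \<gamma> \<in> reach (D \<zeta>) \<delta> i" by blast
  obtain \<zeta> where \<zeta>: "\<zeta> \<in> Z" "\<zeta>0 \<sqsubseteq> \<zeta>" "I \<zeta> \<sqsubseteq> i" using i(3) \<gamma>(3) by blast
  have "closed_pt (P (D \<zeta>)) \<gamma>" using \<gamma>(2) \<zeta>(1) int by blast
  then show False using I(2)[OF i(1) \<zeta>(3)] \<gamma>(1,4) \<zeta>(1,2) by blast
qed

section \<open>Common gaps in the sets \<open>B b i\<close>\<close>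

definition B :: "'l \<Rightarrow> 'a \<Rightarrow> 'l set" where
  "B = reach (SOME D. \<forall>p. (\<forall>x\<in>L. p x \<in> L) \<longrightarrow>
     (\<exists>\<delta>\<in>L. \<forall>i0\<in>K. \<exists>i\<in>K. i0 \<sqsubseteq> i \<and> (\<exists>e\<in>reach D \<delta> i. big i e \<and> closed_pt p e)))"

lemma B_guess:
  "\<forall>x\<in>L. p x \<in> L \<Longrightarrow> \<exists>\<delta>\<in>L. \<forall>i0\<in>K. \<exists>i\<in>K. i0 \<sqsubseteq> i \<and> (\<exists>e\<in>B \<delta> i. big i e \<and> closed_pt p e)"
  using someI_ex[OF guessing] unfolding B_def by blast

lemma B_le: "b \<in> L \<Longrightarrow> y \<in> B b i \<Longrightarrow> y \<in> L \<and> y \<unlhd> b"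
  unfolding B_def by (rule reach_le)

lemma B_trans: "y \<in> B b i \<Longrightarrow> B y i \<subseteq> B b i"
  unfolding B_def by (rule reach_trans)

lemma B_card: "b \<in> L \<Longrightarrow> i \<in> K \<Longrightarrow> |B b i| \<le>o |Mu i|"
  unfolding B_def by (rule reach_card)

lemma B_eventually: "b \<in> L \<Longrightarrow> y \<in> L \<Longrightarrow> y \<lhd> b \<Longrightarrow> \<exists>i0\<in>K. \<forall>i\<in>K. i0 \<sqsubseteq> i \<longrightarrow> y \<in> B b i"
  unfolding B_def by (rule reach_eventually)

text \<open>The thresholds of the fewer than \<kappa> members of \<open>s x\<close> are bounded in
  the regular cardinal \<kappa>.\<close>

lemma family_B_eventually:
  assumes s: "family s" and x: "x \<in> L" and y: "y \<in> L" "y \<lhd> x"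
  shows "\<exists>i0\<in>K. \<forall>b\<in>s x. \<forall>i\<in>K. i0 \<sqsubseteq> i \<longrightarrow> y \<in> B b i"
proof -
  have sx: "s x \<subseteq> {y\<in>L. x \<unlhd> y}" "|s x| <o |K|" using s x unfolding family_def by auto
  have "\<forall>b\<in>s x. \<exists>i0\<in>K. \<forall>i\<in>K. i0 \<sqsubseteq> i \<longrightarrow> y \<in> B b i"
  proof
    fix b assume "b \<in> s x"
    then have "b \<in> L" "x \<unlhd> b" using sx by auto
    then show "\<exists>i0\<in>K. \<forall>i\<in>K. i0 \<sqsubseteq> i \<longrightarrow> y \<in> B b i"
      using B_eventually[of b y] y by auto
  qed
  then obtain I where I: "\<forall>b\<in>s x. I b \<in> K \<and> (\<forall>i\<in>K. I b \<sqsubseteq> i \<longrightarrow> y \<in> B b i)" by metis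
  then obtain i0 where i0: "i0 \<in> K" "\<forall>b\<in>s x. I b \<sqsubset> i0" using K_bdd_image[OF sx(2), of I] by blast
  have "y \<in> B b i" if "b \<in> s x" "i \<in> K" "i0 \<sqsubseteq> i" for b i
  proof -
    have "I b \<sqsubset> i0" using i0 that by blast
    then have "I b \<sqsubseteq> i" using that(3) by order
    then show ?thesis using I that by blast
  qed
  then show ?thesis using i0 by blast
qed

text \<open>The set collects indices. The gap itself lies strictly between \<open>\<eta>\<close> and
  \<open>e\<close> and is common to all members of \<open>s x\<close>; \<open>q\<close> prescribes a
  further common point.\<close>

definition gap :: "('l \<Rightarrow> 'l set) \<Rightarrow> 'l \<Rightarrow> 'a \<Rightarrow> 'l \<Rightarrow> 'l \<Rightarrow> 'l set" where
  "gap s q i \<eta> e = {x\<in>L. \<forall>b\<in>s x. q \<in> B b i \<and> e \<in> B b i \<and> (\<forall>y\<in>B b i. y \<lhd> e \<longrightarrow> y \<unlhd> \<eta>)}"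

text \<open>Otherwise \<open>w i \<eta>\<close> bounds the suitable \<open>e\<close> for each
  \<open>i\<close> and \<open>\<eta>\<close>. Guess a big \<open>e\<close> closed under a
  \<open>p\<close> that outgrows all \<open>w i\<close>. It tops a gap with a lower end
  \<open>h\<close> shared by unboundedly many \<open>x\<close>, so it is at most
  \<open>w i h\<close>, which is below \<open>p h\<close> and hence below \<open>e\<close>.\<close>

lemma unb_gaps:
  assumes s: "family s" and q: "q \<in> L"
  shows "\<exists>i\<in>K. \<exists>\<eta>\<in>L. unb {e\<in>L. \<eta> \<lhd> e \<and> unb (gap s q i \<eta> e)}"
proof (rule ccontr)
  assume neg: "\<not> ?thesis"
  define E where "E i \<eta> = {e\<in>L. \<eta> \<lhd> e \<and> unb (gap s q i \<eta> e)}" for i \<eta>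
  have "\<exists>w\<in>L. \<forall>e\<in>E i \<eta>. e \<unlhd> w" if "i \<in> K" "\<eta> \<in> L" for i \<eta>
  proof -
    have "\<not> unb (E i \<eta>)" using neg that unfolding E_def by blast
    moreover have "E i \<eta> \<subseteq> L" unfolding E_def by blast
    ultimately show ?thesis unfolding unb_def L.not_less[symmetric] by blast
  qed
  then obtain w where w: "\<And>i \<eta>. i \<in> K \<Longrightarrow> \<eta> \<in> L \<Longrightarrow> w i \<eta> \<in> L"
    "\<And>i \<eta> e. i \<in> K \<Longrightarrow> \<eta> \<in> L \<Longrightarrow> e \<in> E i \<eta> \<Longrightarrow> e \<unlhd> w i \<eta>" by metis
  have "\<forall>\<eta>\<in>L. \<exists>z\<in>L. \<forall>i\<in>K. w i \<eta> \<lhd> z" using L_bdd_image[OF K_le_N] w(1) by simp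
  then obtain p where p: "\<forall>\<eta>\<in>L. p \<eta> \<in> L \<and> (\<forall>i\<in>K. w i \<eta> \<lhd> p \<eta>)" by metis
  then obtain \<delta> where \<delta>: "\<delta> \<in> L"
    "\<forall>i0\<in>K. \<exists>i\<in>K. i0 \<sqsubseteq> i \<and> (\<exists>e\<in>B \<delta> i. big i e \<and> closed_pt p e)" using B_guess[of p] by blast
  obtain d where d: "d \<in> L" "\<delta> \<unlhd> d" "q \<unlhd> d" using L_upper2[OF \<delta>(1) q] by blast
  have "\<exists>i0\<in>K. \<forall>b\<in>s x. \<forall>i\<in>K. i0 \<sqsubseteq> i \<longrightarrow> \<delta> \<in> B b i \<and> q \<in> B b i" if x: "x \<in> L" "d \<lhd> x" for x
  proof -
    have "\<delta> \<lhd> x" "q \<lhd> x" using d x by order+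
    then obtain i1 i2 where i1: "i1 \<in> K" "\<forall>b\<in>s x. \<forall>i\<in>K. i1 \<sqsubseteq> i \<longrightarrow> \<delta> \<in> B b i"
      and i2: "i2 \<in> K" "\<forall>b\<in>s x. \<forall>i\<in>K. i2 \<sqsubseteq> i \<longrightarrow> q \<in> B b i"
      using family_B_eventually[OF s x(1) \<delta>(1)] family_B_eventually[OF s x(1) q] by blast
    then obtain i0 where i0: "i0 \<in> K" "i1 \<sqsubseteq> i0" "i2 \<sqsubseteq> i0" using K_upper2[OF i1(1) i2(1)] by blast
    have "\<delta> \<in> B b i \<and> q \<in> B b i" if "b \<in> s x" "i \<in> K" "i0 \<sqsubseteq> i" for b i
    proof -
      have "i1 \<sqsubseteq> i" "i2 \<sqsubseteq> i" using i0 that by order+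
      then show ?thesis using i1(2) i2(2) that by blast
    qed
    then show ?thesis using i0(1) by blast
  qed
  \<comment> \<open>\<open>I x\<close> is a threshold for all of \<open>s x\<close>; by pigeonhole
    it is then made constant on an unbounded set.\<close>
  then obtain I where I: "\<And>x. x \<in> L \<Longrightarrow> d \<lhd> x \<Longrightarrow> I x \<in> K"
    "\<And>x b i. x \<in> L \<Longrightarrow> d \<lhd> x \<Longrightarrow> b \<in> s x \<Longrightarrow> i \<in> K \<Longrightarrow> I x \<sqsubseteq> i \<Longrightarrow> \<delta> \<in> B b i \<and> q \<in> B b i" by metis
  have "unb {x\<in>L. d \<lhd> x}" using unb_above[of L d] L_greater d(1) unfolding unb_def by blast
  then obtain i1 where i1: "i1 \<in> K" and V: "unb {x\<in>{x\<in>L. d \<lhd> x}. I x = i1}"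
    using unb_fibre[OF _ K_le_N, of "{x\<in>L. d \<lhd> x}" I] I(1) by blast
  obtain i e where i: "i \<in> K" "i1 \<sqsubseteq> i" and e: "e \<in> B \<delta> i" "big i e" "closed_pt p e"
    using \<delta>(2) i1 by blast
  have eL: "e \<in> L" using B_le[OF \<delta>(1) e(1)] by simp
  let ?V = "{x\<in>{x\<in>L. d \<lhd> x}. I x = i1}"
  have "\<forall>x\<in>?V. \<exists>\<eta>. \<eta> \<in> L \<and> \<eta> \<lhd> e \<and> (\<forall>b\<in>s x. \<forall>y\<in>B b i. y \<lhd> e \<longrightarrow> y \<unlhd> \<eta>)"
  proof
    fix x assume x: "x \<in> ?V"
    let ?X = "{y\<in>\<Union>b\<in>s x. B b i. y \<lhd> e}"
    have sx: "s x \<subseteq> L" "|s x| <o |K|" using s x unfolding family_def by auto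
    have "|s x| \<le>o |Mu i|" using ordLess_imp_ordLeq[OF ordLess_transitive[OF sx(2) K_Mu[OF i(1)]]] .
    then have "|\<Union>b\<in>s x. B b i| \<le>o |Mu i|"
      by (rule card_of_UNION_ordLeq_infinite[OF Mu_infinite[OF i(1)]]) (use B_card i sx in blast)
    then have "|?X| \<le>o |Mu i|" by (rule ordLeq_transitive[OF card_of_mono1, rotated]) blast
    \<comment> \<open>The sets \<open>B b i\<close> for \<open>b\<close> in \<open>s x\<close> have
      at most \<open>|Mu i|\<close> points together, so bigness of \<open>e\<close> leaves room
      between them and \<open>e\<close>.\<close>
    moreover have "?X \<subseteq> {y\<in>L. y \<lhd> e}" using sx B_le by blast
    ultimately obtain \<eta> where "\<eta> \<in> L" "\<eta> \<lhd> e" "\<forall>y\<in>?X. y \<lhd> \<eta>" using e(2) unfolding big_def by blast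
    then show "\<exists>\<eta>. \<eta> \<in> L \<and> \<eta> \<lhd> e \<and> (\<forall>b\<in>s x. \<forall>y\<in>B b i. y \<lhd> e \<longrightarrow> y \<unlhd> \<eta>)"
      using L.less_imp_le by (intro exI[of _ \<eta>]) blast
  qed
  from bchoice[OF this] obtain \<eta>
    where "\<forall>x\<in>?V. \<eta> x \<in> L \<and> \<eta> x \<lhd> e \<and> (\<forall>b\<in>s x. \<forall>y\<in>B b i. y \<lhd> e \<longrightarrow> y \<unlhd> \<eta> x)" by blast
  then have \<eta>: "\<And>x. x \<in> ?V \<Longrightarrow> \<eta> x \<in> {\<eta>\<in>L. \<eta> \<lhd> e}"
    "\<And>x b y. x \<in> ?V \<Longrightarrow> b \<in> s x \<Longrightarrow> y \<in> B b i \<Longrightarrow> y \<lhd> e \<Longrightarrow> y \<unlhd> \<eta> x" by simp_all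
  \<comment> \<open>At most \<open>|N|\<close> ordinals lie below \<open>e\<close>, so a pigeonhole
    makes the lower end of the gap independent of \<open>x\<close>.\<close>
  obtain h where h: "h \<in> L" "h \<lhd> e" and U: "unb {x\<in>?V. \<eta> x = h}"
    using unb_fibre[OF V L_seg[OF eL], of \<eta>] \<eta>(1) by blast
  have "{x\<in>?V. \<eta> x = h} \<subseteq> gap s q i h e"
  proof
    fix x assume x: "x \<in> {x\<in>?V. \<eta> x = h}"
    have "q \<in> B b i \<and> e \<in> B b i \<and> (\<forall>y\<in>B b i. y \<lhd> e \<longrightarrow> y \<unlhd> h)" if b: "b \<in> s x" for b
    proof -
      \<comment> \<open>Since \<open>\<delta>\<close> is in \<open>B b i\<close>, transitivity puts
        the guessed \<open>e\<close> there as well.\<close>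
      have "\<delta> \<in> B b i \<and> q \<in> B b i" using I(2)[of x b i] x b i by blast
      then show ?thesis using B_trans e(1) \<eta>(2)[of x b] x b by blast
    qed
    then show "x \<in> gap s q i h e" using x unfolding gap_def by blast
  qed
  moreover have "gap s q i h e \<subseteq> L" unfolding gap_def by blast
  ultimately have "unb (gap s q i h e)" by (rule unb_mono[OF U])
  then have "e \<in> E i h" using eL h unfolding E_def by blast
  then have "e \<unlhd> w i h" "w i h \<lhd> p h" using w(2) p i h by blast+
  moreover have "p h \<lhd> e" using e(3) h unfolding closed_pt_def by blast
  ultimately show False by order
qed

section \<open>The colouring\<close>

text \<open>For \<open>a\<close> below \<open>b\<close> the coordinates with
  \<open>f b j \<sqsubseteq> f a j\<close> are bounded but need not have a last one, and then the
  choice is arbitrary. The proof evaluates it only through \<open>last_fall_eq\<close>.\<close>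

definition last_fall :: "'l \<Rightarrow> 'l \<Rightarrow> 'a" where
  "last_fall a b = (SOME j. j \<in> K \<and> f b j \<sqsubseteq> f a j \<and> (\<forall>i\<in>K. j \<sqsubset> i \<longrightarrow> f a i \<sqsubset> f b i))"

lemma last_fall_eq:
  assumes "j \<in> K" "f b j \<sqsubseteq> f a j" "\<forall>i\<in>K. j \<sqsubset> i \<longrightarrow> f a i \<sqsubset> f b i"
  shows "last_fall a b = j"
  unfolding last_fall_def
proof (rule some_equality)
  show "j \<in> K \<and> f b j \<sqsubseteq> f a j \<and> (\<forall>i\<in>K. j \<sqsubset> i \<longrightarrow> f a i \<sqsubset> f b i)" using assms by blast
next
  fix j' assume j': "j' \<in> K \<and> f b j' \<sqsubseteq> f a j' \<and> (\<forall>i\<in>K. j' \<sqsubset> i \<longrightarrow> f a i \<sqsubset> f b i)"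
  have "\<not> j \<sqsubset> j'"
  proof
    assume "j \<sqsubset> j'"
    then have "f a j' \<sqsubset> f b j'" using assms(3) j' by blast
    moreover have "f b j' \<sqsubseteq> f a j'" using j' by blast
    ultimately show False by order
  qed
  moreover have "\<not> j' \<sqsubset> j"
  proof
    assume "j' \<sqsubset> j"
    then have "f a j \<sqsubset> f b j" using assms(1) j' by blast
    with assms(2) show False by simp
  qed
  ultimately show "j' = j" by order
qed

text \<open>One coordinate has to carry three parameters and still be as large as desired.\<close>

definition codes :: "('a \<Rightarrow> 'a \<times> 'a \<times> 'a) \<Rightarrow> bool" where
  "codes h \<longleftrightarrow> (\<forall>t\<in>K \<times> K \<times> K. \<forall>j\<in>K. \<exists>j'\<in>K. j \<sqsubset> j' \<and> h j' = t)"

text \<open>Under an injection of \<open>K \<times> (K \<times> K \<times> K)\<close> into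
  \<open>K\<close> every triple has \<kappa> many codes, too many for a proper initial
  segment.\<close>

lemma ex_codes: "\<exists>h. codes h"
proof -
  let ?T = "K \<times> K \<times> K"
  have refl: "|K| \<le>o |K|" by (rule ordLeq_reflexive[OF card_of_Well_order])
  have "|K \<times> ?T| \<le>o |K|" by (intro card_of_Times_le K_infinite refl)
  then obtain \<phi> where \<phi>: "inj_on \<phi> (K \<times> ?T)" "\<phi> ` (K \<times> ?T) \<subseteq> K"
    using card_of_ordLeq[of "K \<times> ?T" K] by auto
  define h where "h j = snd (inv_into (K \<times> ?T) \<phi> j)" for j
  have "\<exists>j'\<in>K. j \<sqsubset> j' \<and> h j' = t" if t: "t \<in> ?T" and j: "j \<in> K" for t j
  proof (rule ccontr)
    assume neg: "\<not> ?thesis"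
    obtain j2 where j2: "j2 \<in> K" "j \<sqsubset> j2" using K_greater[OF j] by blast
    have "(\<lambda>x. \<phi> (x, t)) ` K \<subseteq> {i\<in>K. i \<sqsubset> j2}"
    proof
      fix y assume "y \<in> (\<lambda>x. \<phi> (x, t)) ` K"
      then obtain x where x: "x \<in> K" "y = \<phi> (x, t)" by blast
      have xt: "(x, t) \<in> K \<times> ?T" using x t by simp
      then have "y \<in> K" using \<phi>(2) x(2) by blast
      moreover have "h y = t" unfolding h_def x(2) using inv_into_f_f[OF \<phi>(1) xt] by simp
      ultimately have "\<not> j \<sqsubset> y" using neg by blast
      then have "y \<sqsubset> j2" using j2(2) by order
      then show "y \<in> {i\<in>K. i \<sqsubset> j2}" using \<open>y \<in> K\<close> by simp
    qed
    moreover have "inj_on (\<lambda>x. \<phi> (x, t)) K"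
      using t by (auto intro!: inj_onI dest: inj_onD[OF \<phi>(1)])
    ultimately have "|K| \<le>o |{i\<in>K. i \<sqsubset> j2}|" by (intro card_of_ordLeq[THEN iffD1] exI conjI)
    then show False using K_seg[OF j2(1)] not_ordLeq_ordLess[of "|K|"] by blast
  qed
  then show ?thesis unfolding codes_def by blast
qed

definition upper :: "'l \<Rightarrow> 'l \<Rightarrow> 'a \<Rightarrow> 'l" where
  "upper a b i = L.Least (\<lambda>y. y \<in> B b i \<and> a \<unlhd> y)"

definition lower :: "'l \<Rightarrow> 'l \<Rightarrow> 'a \<Rightarrow> 'a \<Rightarrow> 'l" where
  "lower a b i i' = L.Least (\<lambda>y. y \<in> B a i \<and> (\<forall>z\<in>B b i'. z \<lhd> a \<longrightarrow> z \<lhd> y))"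

text \<open>The value of \<open>d\<close> is read as the rank of an ordinal below
  \<open>upper a b i'\<close>. If it is no such rank, the result is arbitrary and may even lie
  outside \<open>L\<close>.\<close>

definition colour :: "('a \<Rightarrow> 'a \<times> 'a \<times> 'a) \<Rightarrow> ('a \<Rightarrow> 'a \<Rightarrow> 'a \<Rightarrow> 'a) \<Rightarrow> 'l \<Rightarrow> 'l \<Rightarrow> 'l" where
  "colour h d a b = (case h (last_fall a b) of (i, i', k) \<Rightarrow>
     inv_into {y\<in>L. y \<lhd> upper a b i'} (rank (upper a b i'))
       (d k (f (lower a b i i') k) (f (upper a b i') k)))"

section \<open>Every colour is realised\<close>

text \<open>The function \<open>p\<close> pushes the second index beyond a value depending on the
  first, which later keeps the original indices in increasing order.\<close>

theorem colour_realised: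
  assumes h: "codes h"
    and d: "\<And>k S T \<sigma>. k \<in> K \<Longrightarrow> S \<subseteq> Mu k \<Longrightarrow> T \<subseteq> Mu k \<Longrightarrow> \<forall>z\<in>Mu k. \<exists>x\<in>S. z \<sqsubset> x \<Longrightarrow>
      \<forall>z\<in>Mu k. \<exists>x\<in>T. z \<sqsubset> x \<Longrightarrow> \<sigma> \<in> Mu k \<Longrightarrow> \<exists>x\<in>S. \<exists>y\<in>T. d k x y = \<sigma>"
    and s: "family s" and \<epsilon>: "\<epsilon> \<in> L" and p: "\<And>x. x \<in> L \<Longrightarrow> p x \<in> L"
  shows "\<exists>x\<in>L. \<exists>y\<in>L. p x \<lhd> y \<and> (\<forall>a\<in>s x. \<forall>b\<in>s y. a \<lhd> b \<and> colour h d a b = \<epsilon>)"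
proof -
  obtain i \<eta> where i: "i \<in> K" and \<eta>: "\<eta> \<in> L" and X: "unb {e\<in>L. \<eta> \<lhd> e \<and> unb (gap s \<epsilon> i \<eta> e)}"
    (is "unb ?X") using unb_gaps[OF s \<epsilon>] by blast
  have "\<forall>e\<in>?X. \<exists>j0. j0 \<in> K \<and> (\<forall>j\<in>K. j0 \<sqsubseteq> j \<longrightarrow> (\<forall>\<xi>\<in>Mu j. unb {x\<in>gap s \<epsilon> i \<eta> e. \<forall>a\<in>s x. \<xi> \<sqsubset> f a j}))"
    using unb_large_values[OF s] by (simp add: Bex_def)
  from bchoice[OF this] obtain J where J: "\<forall>e\<in>?X. J e \<in> K \<and> (\<forall>j\<in>K. J e \<sqsubseteq> j \<longrightarrow>
      (\<forall>\<xi>\<in>Mu j. unb {x\<in>gap s \<epsilon> i \<eta> e. \<forall>a\<in>s x. \<xi> \<sqsubset> f a j}))"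
    by blast
  obtain j0 where j0: "j0 \<in> K" and X1: "unb {e\<in>?X. J e = j0}"
    using unb_fibre[OF X K_le_N, of J] J by blast
  \<comment> \<open>This \<open>q\<close> will lie in every \<open>B b i'\<close> and below
    \<open>a\<close>. A candidate for \<open>lower\<close> must then exceed \<open>q\<close>, hence
    \<open>\<eta>\<close>, and \<open>B a i\<close> has nothing strictly between
    \<open>\<eta>\<close> and \<open>e\<close>.\<close>
  obtain q where q: "q \<in> L" "\<eta> \<lhd> q" using L_greater[OF \<eta>] by blast
  obtain i' \<zeta> where i': "i' \<in> K" and \<zeta>: "\<zeta> \<in> L"
    and Y: "unb {e\<in>L. \<zeta> \<lhd> e \<and> unb (gap s q i' \<zeta> e)}" (is "unb ?Y")
    using unb_gaps[OF s q(1)] by blast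
  \<comment> \<open>Candidates for \<open>e'\<close> must lie beyond \<open>\<epsilon>\<close> to
    rank it; candidates for \<open>e\<close> must lie beyond \<open>\<zeta>\<close>, which will
    bound the points of \<open>B b i'\<close> below \<open>a\<close>.\<close>
  let ?Y1 = "{e\<in>?Y. \<epsilon> \<lhd> e}" and ?X2 = "{e\<in>{e\<in>?X. J e = j0}. \<zeta> \<lhd> e}"
  have Y1: "unb ?Y1" and X2: "unb ?X2" using unb_above[OF Y \<epsilon>] unb_above[OF X1 \<zeta>] by auto
  have rank_Y1: "rank e \<epsilon> \<in> N" if "e \<in> ?Y1" for e using that rank(2)[of e \<epsilon>] \<epsilon> by blast
  have NN: "|N| \<le>o |N|" by (rule ordLeq_reflexive[OF card_of_Well_order])
  \<comment> \<open>With the rank of \<open>\<epsilon>\<close> constant, the colouring of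
    \<open>Mu k\<close> only has to produce this one value.\<close>
  obtain \<sigma> where \<sigma>: "\<sigma> \<in> N" and Y2: "unb {e\<in>?Y1. rank e \<epsilon> = \<sigma>}" (is "unb ?Y2")
    using unb_fibre[OF Y1 NN, of "\<lambda>e. rank e \<epsilon>"] rank_Y1 by blast
  obtain k0 where k0: "k0 \<in> K" "\<sigma> \<in> Mu k0" using \<sigma> Mu_N by blast
  obtain k1 where k1: "k1 \<in> K" "\<forall>j\<in>K. k1 \<sqsubseteq> j \<longrightarrow> (\<forall>\<xi>\<in>Mu j. unb {x\<in>?X2. \<xi> \<sqsubset> f x j})"
    using unb_large_values[OF family_singleton X2] by auto
  obtain k2 where k2: "k2 \<in> K" "\<forall>j\<in>K. k2 \<sqsubseteq> j \<longrightarrow> (\<forall>\<xi>\<in>Mu j. unb {x\<in>?Y2. \<xi> \<sqsubset> f x j})"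
    using unb_large_values[OF family_singleton Y2] by auto
  obtain k12 where k12: "k12 \<in> K" "k1 \<sqsubseteq> k12" "k2 \<sqsubseteq> k12" using K_upper2[OF k1(1) k2(1)] by blast
  obtain k where k: "k \<in> K" "k0 \<sqsubseteq> k" "k12 \<sqsubseteq> k" using K_upper2[OF k0(1) k12(1)] by blast
  have \<sigma>k: "\<sigma> \<in> Mu k" using k0 k(1,2) Mu_mono[of k0 k] by (cases "k0 = k") (auto simp: A.le_less)
  have "k1 \<sqsubseteq> k" "k2 \<sqsubseteq> k" using k12 k by order+
  then have kX: "\<forall>\<xi>\<in>Mu k. unb {x\<in>?X2. \<xi> \<sqsubset> f x k}" and kY: "\<forall>\<xi>\<in>Mu k. unb {x\<in>?Y2. \<xi> \<sqsubset> f x k}"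
    using k1(2) k2(2) k(1) by blast+
  have "\<forall>\<xi>\<in>Mu k. \<exists>e. e \<in> ?X2 \<and> \<xi> \<sqsubset> f e k" using kX q(1) unfolding unb_def by blast
  then obtain E where E: "\<forall>\<xi>\<in>Mu k. E \<xi> \<in> ?X2 \<and> \<xi> \<sqsubset> f (E \<xi>) k"
    using bchoice[of "Mu k" "\<lambda>\<xi> e. e \<in> ?X2 \<and> \<xi> \<sqsubset> f e k"] by blast
  obtain c where c: "c \<in> L" "q \<unlhd> c" "\<zeta> \<unlhd> c" using L_upper2[OF q(1) \<zeta>] by blast
  have "\<exists>x. x \<in> gap s \<epsilon> i \<eta> (E \<upsilon>) \<and> c \<lhd> x \<and> (\<forall>a\<in>s x. \<xi> \<sqsubset> f a j)"
    if "\<upsilon> \<in> Mu k" "j \<in> K" "j0 \<sqsubseteq> j" "\<xi> \<in> Mu j" for \<upsilon> j \<xi>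
  proof -
    have "E \<upsilon> \<in> ?X" "J (E \<upsilon>) = j0" using E that(1) by blast+
    then have "unb {x\<in>gap s \<epsilon> i \<eta> (E \<upsilon>). \<forall>a\<in>s x. \<xi> \<sqsubset> f a j}" using J that by blast
    then show ?thesis using c(1) unfolding unb_def by blast
  qed
  note \<alpha>_ex = this
  \<comment> \<open>The index \<open>x\<close> depends on \<open>j\<close> and \<open>\<xi>\<close>,
    which are known only after \<open>e'\<close> and \<open>\<beta>\<close>, yet it must lie below
    \<open>e'\<close>. So an index is selected beforehand for every possible triple. There are at
    most \<open>|N|\<close> triples, and \<open>r\<close> bounds all the selected indices;
    \<open>e'\<close> is taken beyond \<open>r\<close>.\<close>
  define \<alpha> where "\<alpha> \<upsilon> j \<xi> = (SOME x. x \<in> gap s \<epsilon> i \<eta> (E \<upsilon>) \<and> c \<lhd> x \<and> (\<forall>a\<in>s x. \<xi> \<sqsubset> f a j))" for \<upsilon> j \<xi>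
  have \<alpha>: "\<alpha> \<upsilon> j \<xi> \<in> gap s \<epsilon> i \<eta> (E \<upsilon>) \<and> c \<lhd> \<alpha> \<upsilon> j \<xi> \<and> (\<forall>a\<in>s (\<alpha> \<upsilon> j \<xi>). \<xi> \<sqsubset> f a j)"
    if "\<upsilon> \<in> Mu k" "j \<in> K" "j0 \<sqsubseteq> j" "\<xi> \<in> Mu j" for \<upsilon> j \<xi>
    unfolding \<alpha>_def by (rule someI_ex[OF \<alpha>_ex[OF that]])
  have \<alpha>L: "\<alpha> \<upsilon> j \<xi> \<in> L" if "\<upsilon> \<in> Mu k" "j \<in> K" "j0 \<sqsubseteq> j" "\<xi> \<in> Mu j" for \<upsilon> j \<xi>
    using \<alpha>[OF that] unfolding gap_def by blast
  have s_card: "|s x| <o |K|" and s_sub: "s x \<subseteq> {y\<in>L. x \<unlhd> y}" if "x \<in> L" for x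
    using s that unfolding family_def by blast+
  let ?R = "Mu k \<times> (SIGMA j:{j\<in>K. j0 \<sqsubseteq> j}. Mu j)"
  have u_ex: "\<exists>u. u \<in> L \<and> p x \<lhd> u \<and> (\<forall>a\<in>s x. a \<lhd> u)" if x: "x \<in> L" for x
  proof -
    have "|s x| \<le>o |N|" using ordLess_imp_ordLeq[OF ordLess_ordLeq_trans[OF s_card[OF x] K_le_N]] .
    then obtain u where u: "u \<in> L" "\<forall>a\<in>s x. a \<lhd> u" using L_bdd[of "s x"] s_sub[OF x] by blast
    obtain v where v: "v \<in> L" "p x \<lhd> v" using L_greater[OF p[OF x]] by blast
    obtain w where w: "w \<in> L" "u \<unlhd> w" "v \<unlhd> w" using L_upper2[OF u(1) v(1)] by blast
    have "p x \<lhd> w" using v w by order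
    moreover have "a \<lhd> w" if "a \<in> s x" for a using L.less_le_trans[OF u(2)[rule_format, OF that] w(2)] .
    ultimately show ?thesis using w(1) by blast
  qed
  define u where "u x = (SOME u. u \<in> L \<and> p x \<lhd> u \<and> (\<forall>a\<in>s x. a \<lhd> u))" for x
  have u: "u x \<in> L \<and> p x \<lhd> u x \<and> (\<forall>a\<in>s x. a \<lhd> u x)" if "x \<in> L" for x
    unfolding u_def by (rule someI_ex[OF u_ex[OF that]])
  have "|SIGMA j:{j\<in>K. j0 \<sqsubseteq> j}. Mu j| \<le>o |N|"
    by (rule card_of_Sigma_ordLeq_infinite[OF N_infinite ordLeq_transitive[OF card_of_mono1 K_le_N]])
      (use Mu_le_N in auto)
  then have R: "|?R| \<le>o |N|"
    by (intro card_of_Sigma_ordLeq_infinite[OF N_infinite Mu_le_N[OF k(1)]]) simp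
  have "\<exists>r\<in>L. \<forall>t\<in>?R. (case t of (\<upsilon>, j, \<xi>) \<Rightarrow> u (\<alpha> \<upsilon> j \<xi>)) \<lhd> r"
    by (rule L_bdd_image[OF R]) (use u \<alpha>L in auto)
  then obtain r where r: "r \<in> L"
    "\<And>\<upsilon> j \<xi>. \<upsilon> \<in> Mu k \<Longrightarrow> j \<in> K \<Longrightarrow> j0 \<sqsubseteq> j \<Longrightarrow> \<xi> \<in> Mu j \<Longrightarrow> u (\<alpha> \<upsilon> j \<xi>) \<lhd> r"
    by fastforce
  have "\<exists>x\<in>(\<lambda>\<upsilon>. f (E \<upsilon>) k) ` Mu k. \<exists>y\<in>(\<lambda>e. f e k) ` {e\<in>?Y2. r \<lhd> e}. d k x y = \<sigma>"
  proof (rule d[OF k(1) _ _ _ _ \<sigma>k])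
    show "(\<lambda>\<upsilon>. f (E \<upsilon>) k) ` Mu k \<subseteq> Mu k" using E f_Mu k(1) by blast
    show "(\<lambda>e. f e k) ` {e\<in>?Y2. r \<lhd> e} \<subseteq> Mu k" using f_Mu k(1) by blast
    show "\<forall>z\<in>Mu k. \<exists>x\<in>(\<lambda>\<upsilon>. f (E \<upsilon>) k) ` Mu k. z \<sqsubset> x" using E by blast
    show "\<forall>z\<in>Mu k. \<exists>x\<in>(\<lambda>e. f e k) ` {e\<in>?Y2. r \<lhd> e}. z \<sqsubset> x"
    proof
      fix z assume "z \<in> Mu k"
      then have "unb {x\<in>?Y2. z \<sqsubset> f x k}" using kY by (rule bspec[rotated])
      then obtain e where "e \<in> {x\<in>?Y2. z \<sqsubset> f x k}" "r \<lhd> e" using r(1) unfolding unb_def by (elim conjE) (drule (1) bspec, blast)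
      then show "\<exists>x\<in>(\<lambda>e. f e k) ` {e\<in>?Y2. r \<lhd> e}. z \<sqsubset> x" by (intro bexI[of _ "f e k"] imageI) simp_all
    qed
  qed
  then obtain \<upsilon> e' where \<upsilon>: "\<upsilon> \<in> Mu k" and e': "e' \<in> ?Y2" "r \<lhd> e'" "d k (f (E \<upsilon>) k) (f e' k) = \<sigma>"
    by blast
  define e where "e = E \<upsilon>"
  have e: "e \<in> ?X" "\<zeta> \<lhd> e" "e \<in> L" using E \<upsilon> unfolding e_def by blast+
  have e'_props: "e' \<in> L" "\<epsilon> \<lhd> e'" "rank e' \<epsilon> = \<sigma>" "unb (gap s q i' \<zeta> e')" "\<zeta> \<lhd> e'" using e'(1) by blast+
  \<comment> \<open>A function in the product bounds all preselected sets at once: at coordinate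
    \<open>l\<close> only \<open>j\<close> below \<open>l\<close> count, each with
    \<open>|Mu j|\<close> many \<open>\<xi>\<close>, so regularity of \<open>Mu l\<close>
    applies.\<close>
  have "\<forall>l\<in>K. \<exists>g. g \<in> Mu l \<and> (\<forall>j\<in>K. j0 \<sqsubseteq> j \<longrightarrow> j \<sqsubset> l \<longrightarrow> (\<forall>\<xi>\<in>Mu j. \<forall>a\<in>s (\<alpha> \<upsilon> j \<xi>). f a l \<sqsubset> g))"
  proof
    fix l assume l: "l \<in> K"
    have g1_ex: "\<exists>g\<in>Mu l. \<forall>a\<in>s (\<alpha> \<upsilon> j \<xi>). f a l \<sqsubset> g" if j: "j \<in> K" "j0 \<sqsubseteq> j" "\<xi> \<in> Mu j" for j \<xi>
    proof (rule Mu_bdd_image[OF l])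
      have x: "\<alpha> \<upsilon> j \<xi> \<in> L" by (rule \<alpha>L[OF \<upsilon> j])
      show "|s (\<alpha> \<upsilon> j \<xi>)| <o |Mu l|" by (rule ordLess_transitive[OF s_card[OF x] K_Mu[OF l]])
      show "f a l \<in> Mu l" if "a \<in> s (\<alpha> \<upsilon> j \<xi>)" for a using that s_sub[OF x] f_Mu l by blast
    qed
    define g1 where "g1 j \<xi> = (SOME g. g \<in> Mu l \<and> (\<forall>a\<in>s (\<alpha> \<upsilon> j \<xi>). f a l \<sqsubset> g))" for j \<xi>
    have g1: "g1 j \<xi> \<in> Mu l \<and> (\<forall>a\<in>s (\<alpha> \<upsilon> j \<xi>). f a l \<sqsubset> g1 j \<xi>)" if "j \<in> K" "j0 \<sqsubseteq> j" "\<xi> \<in> Mu j" for j \<xi>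
      unfolding g1_def by (rule someI_ex[OF g1_ex[OF that, unfolded Bex_def]])
    have g2_ex: "\<exists>g\<in>Mu l. \<forall>\<xi>\<in>Mu j. g1 j \<xi> \<sqsubset> g" if j: "j \<in> {j\<in>K. j0 \<sqsubseteq> j \<and> j \<sqsubset> l}" for j
      by (rule Mu_bdd_image[OF l Mu_less]) (use j l g1 in auto)
    define g2 where "g2 j = (SOME g. g \<in> Mu l \<and> (\<forall>\<xi>\<in>Mu j. g1 j \<xi> \<sqsubset> g))" for j
    have g2: "g2 j \<in> Mu l \<and> (\<forall>\<xi>\<in>Mu j. g1 j \<xi> \<sqsubset> g2 j)" if "j \<in> {j\<in>K. j0 \<sqsubseteq> j \<and> j \<sqsubset> l}" for j
      unfolding g2_def by (rule someI_ex[OF g2_ex[OF that, unfolded Bex_def]])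
    have "|{j\<in>K. j0 \<sqsubseteq> j \<and> j \<sqsubset> l}| <o |Mu l|"
      by (rule ordLeq_ordLess_trans[OF card_of_mono1 K_Mu[OF l]]) blast
    then have "\<exists>g\<in>Mu l. \<forall>j\<in>{j\<in>K. j0 \<sqsubseteq> j \<and> j \<sqsubset> l}. g2 j \<sqsubset> g"
      by (rule Mu_bdd_image[OF l]) (use g2 in blast)
    then obtain g where g: "g \<in> Mu l" "\<forall>j\<in>{j\<in>K. j0 \<sqsubseteq> j \<and> j \<sqsubset> l}. g2 j \<sqsubset> g" by blast
    have "f a l \<sqsubset> g" if "j \<in> K" "j0 \<sqsubseteq> j" "j \<sqsubset> l" "\<xi> \<in> Mu j" "a \<in> s (\<alpha> \<upsilon> j \<xi>)" for j \<xi> a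
    proof -
      have "f a l \<sqsubset> g1 j \<xi>" "g1 j \<xi> \<sqsubset> g2 j" "g2 j \<sqsubset> g" using g1 g2 g that by blast+
      then show ?thesis by order
    qed
    then show "\<exists>g. g \<in> Mu l \<and> (\<forall>j\<in>K. j0 \<sqsubseteq> j \<longrightarrow> j \<sqsubset> l \<longrightarrow> (\<forall>\<xi>\<in>Mu j. \<forall>a\<in>s (\<alpha> \<upsilon> j \<xi>). f a l \<sqsubset> g))"
      using g(1) by blast
  qed
  from bchoice[OF this] obtain g where "\<forall>l\<in>K. g l \<in> Mu l \<and>
      (\<forall>j\<in>K. j0 \<sqsubseteq> j \<longrightarrow> j \<sqsubset> l \<longrightarrow> (\<forall>\<xi>\<in>Mu j. \<forall>a\<in>s (\<alpha> \<upsilon> j \<xi>). f a l \<sqsubset> g l))" by blast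
  then have g: "\<And>l. l \<in> K \<Longrightarrow> g l \<in> Mu l"
    "\<And>l j \<xi> a. l \<in> K \<Longrightarrow> j \<in> K \<Longrightarrow> j0 \<sqsubseteq> j \<Longrightarrow> j \<sqsubset> l \<Longrightarrow> \<xi> \<in> Mu j \<Longrightarrow> a \<in> s (\<alpha> \<upsilon> j \<xi>) \<Longrightarrow> f a l \<sqsubset> g l"
    by simp_all
  obtain z where z: "z \<in> L" "\<forall>x\<in>L. z \<lhd> x \<longrightarrow> (\<exists>j\<in>K. \<forall>a\<in>s x. \<forall>i\<in>K. j \<sqsubset> i \<longrightarrow> g i \<sqsubset> f a i)"
    using family_eventually_dominates[OF s, of g] g(1) by blast
  obtain z' where z': "z' \<in> L" "z \<unlhd> z'" "e' \<unlhd> z'" using L_upper2[OF z(1) e'_props(1)] by blast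
  obtain \<beta> where \<beta>: "\<beta> \<in> gap s q i' \<zeta> e'" "z' \<lhd> \<beta>" using e'_props(4) z'(1) unfolding unb_def by blast
  have \<beta>L: "\<beta> \<in> L" using \<beta>(1) unfolding gap_def by blast
  have z\<beta>: "z \<lhd> \<beta>" "e' \<lhd> \<beta>" using z' \<beta>(2) by order+
  then obtain j\<beta> where j\<beta>: "j\<beta> \<in> K" "\<forall>b\<in>s \<beta>. \<forall>l\<in>K. j\<beta> \<sqsubset> l \<longrightarrow> g l \<sqsubset> f b l" using z(2) \<beta>L by blast
  obtain j1 where j1: "j1 \<in> K" "j0 \<sqsubseteq> j1" "j\<beta> \<sqsubseteq> j1" using K_upper2[OF j0 j\<beta>(1)] by blast
  \<comment> \<open>This will be the last fall: beyond \<open>j\<beta>\<close> every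
    \<open>f b\<close> exceeds \<open>g\<close>, and beyond \<open>j\<close> itself \<open>g\<close>
    exceeds every \<open>f a\<close>.\<close>
  obtain j where j: "j \<in> K" "j1 \<sqsubset> j" "h j = (i, i', k)"
    using h i i' k(1) j1(1) unfolding codes_def by blast
  have jj: "j0 \<sqsubseteq> j" "j\<beta> \<sqsubset> j" using j1 j(2) by order+
  \<comment> \<open>A separating value: \<open>f b j\<close> is below it on
    \<open>s \<beta>\<close>, and \<open>f a j\<close> is above it for the index preselected for
    it.\<close>
  have "\<exists>\<xi>\<in>Mu j. \<forall>b\<in>s \<beta>. f b j \<sqsubset> \<xi>"
  proof (rule Mu_bdd_image[OF j(1)])
    show "|s \<beta>| <o |Mu j|" by (rule ordLess_transitive[OF s_card[OF \<beta>L] K_Mu[OF j(1)]])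
    show "f b j \<in> Mu j" if "b \<in> s \<beta>" for b using that s_sub[OF \<beta>L] f_Mu j(1) by blast
  qed
  then obtain \<xi> where \<xi>: "\<xi> \<in> Mu j" "\<forall>b\<in>s \<beta>. f b j \<sqsubset> \<xi>" by blast
  define x where "x = \<alpha> \<upsilon> j \<xi>"
  have x: "x \<in> gap s \<epsilon> i \<eta> e" "c \<lhd> x" "\<forall>a\<in>s x. \<xi> \<sqsubset> f a j" "x \<in> L" "u x \<lhd> r"
    using \<alpha>[OF \<upsilon> j(1) jj(1) \<xi>(1)] \<alpha>L[OF \<upsilon> j(1) jj(1) \<xi>(1)] r(2)[OF \<upsilon> j(1) jj(1) \<xi>(1)]
    unfolding x_def e_def by blast+
  have xx: "q \<lhd> x" "\<zeta> \<lhd> x" using c x(2) by order+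
  have "a \<lhd> b \<and> colour h d a b = \<epsilon>" if a: "a \<in> s x" and b: "b \<in> s \<beta>" for a b
  proof -
    have xa: "x \<unlhd> a" "a \<in> L" and \<beta>b: "\<beta> \<unlhd> b" "b \<in> L" using s_sub[OF x(4)] s_sub[OF \<beta>L] a b by blast+
    have "a \<lhd> u x" using u[OF x(4)] a by blast
    then have ae': "a \<lhd> e'" using x(5) e'(2) by order
    have ab: "a \<lhd> b" using ae' z\<beta>(2) \<beta>b(1) by order
    have ga: "e \<in> B a i" "\<forall>y\<in>B a i. y \<lhd> e \<longrightarrow> y \<unlhd> \<eta>" using x(1) a unfolding gap_def by blast+
    have gb: "q \<in> B b i'" "e' \<in> B b i'" "\<forall>y\<in>B b i'. y \<lhd> e' \<longrightarrow> y \<unlhd> \<zeta>" using \<beta>(1) b unfolding gap_def by blast+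
    have lf: "last_fall a b = j"
    proof (rule last_fall_eq[OF j(1)])
      have "f b j \<sqsubset> \<xi>" "\<xi> \<sqsubset> f a j" using \<xi>(2) x(3) a b by blast+
      then show "f b j \<sqsubseteq> f a j" by order
      show "\<forall>l\<in>K. j \<sqsubset> l \<longrightarrow> f a l \<sqsubset> f b l"
      proof (intro ballI impI)
        fix l assume l: "l \<in> K" "j \<sqsubset> l"
        have "f a l \<sqsubset> g l" using g(2)[OF l(1) j(1) jj(1) l(2) \<xi>(1)] a unfolding x_def by blast
        moreover have "j\<beta> \<sqsubset> l" using jj(2) l(2) by order
        then have "g l \<sqsubset> f b l" using j\<beta>(2) l(1) b by blast
        ultimately show "f a l \<sqsubset> f b l" by order
      qed
    qed
    \<comment> \<open>Points of \<open>B b i'\<close> below \<open>e'\<close> are at most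
      \<open>\<zeta>\<close>, which is below \<open>x\<close> and so below \<open>a\<close>.\<close>
    have up: "upper a b i' = e'"
      unfolding upper_def
    proof (rule L.Least_equality)
      show "e' \<in> B b i' \<and> a \<unlhd> e'" using gb(2) ae' by simp
      fix y assume y: "y \<in> B b i' \<and> a \<unlhd> y"
      show "e' \<unlhd> y"
      proof (rule ccontr)
        assume "\<not> e' \<unlhd> y"
        then have "y \<lhd> e'" by simp
        then have "y \<unlhd> \<zeta>" using gb(3) y by blast
        then show False using conjunct2[OF y] xa(1) xx(2) by order
      qed
    qed
    have low: "lower a b i i' = e"
      unfolding lower_def
    proof (rule L.Least_equality)
      have "z \<lhd> e" if z: "z \<in> B b i'" "z \<lhd> a" for z
      proof -
        have "z \<lhd> e'" using z(2) ae' by order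
        then have "z \<unlhd> \<zeta>" using gb(3) z(1) by blast
        then show ?thesis using e(2) by order
      qed
      then show "e \<in> B a i \<and> (\<forall>z\<in>B b i'. z \<lhd> a \<longrightarrow> z \<lhd> e)" using ga(1) by blast
      fix y assume y: "y \<in> B a i \<and> (\<forall>z\<in>B b i'. z \<lhd> a \<longrightarrow> z \<lhd> y)"
      have "q \<lhd> a" using xx(1) xa(1) by order
      then have "q \<lhd> y" using y gb(1) by blast
      show "e \<unlhd> y"
      proof (rule ccontr)
        assume "\<not> e \<unlhd> y"
        then have "y \<lhd> e" by simp
        then have "y \<unlhd> \<eta>" using ga(2) y by blast
        then show False using \<open>q \<lhd> y\<close> q(2) by order
      qed
    qed
    have "colour h d a b = inv_into {y\<in>L. y \<lhd> e'} (rank e') \<sigma>"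
      unfolding colour_def lf j(3) by (simp add: up low e'(3)[folded e_def])
    also have "\<dots> = \<epsilon>"
      using inv_into_f_f[OF rank(1)[OF e'_props(1)], of \<epsilon>] \<epsilon> e'_props(2,3) by simp
    finally show ?thesis using ab by blast
  qed
  moreover have "p x \<lhd> \<beta>"
  proof -
    have "p x \<lhd> u x" using u[OF x(4)] by blast
    then show ?thesis using x(5) e'(2) z\<beta>(2) by order
  qed
  ultimately show ?thesis using x(4) \<beta>L by blast
qed

end

section \<open>From cardinals as relations to the locale\<close>

text \<open>The field comes first, ordered by \<open>r\<close>, and is followed by the rest of the
  type under an arbitrary well-order.\<close>

lemma wellorder_extension:
  fixes r :: "'a rel"
  assumes "Well_order r"
  obtains le lt where "class.wellorder le lt"
    "\<And>x y. x \<in> Field r \<Longrightarrow> y \<in> Field r \<Longrightarrow> le x y \<longleftrightarrow> (x, y) \<in> r"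
proof -
  define w where "w = |UNIV :: 'a set|"
  define le where "le x y \<longleftrightarrow> (if x \<in> Field r then y \<in> Field r \<longrightarrow> (x, y) \<in> r
    else y \<notin> Field r \<and> (x, y) \<in> w)" for x y
  define lt where "lt x y \<longleftrightarrow> le x y \<and> x \<noteq> y" for x y
  have W: "Well_order w" "Field w = UNIV"
    unfolding w_def by (simp_all add: card_of_well_order_on Field_card_of)
  interpret r: wo_rel r using assms by (simp add: wo_rel_def)
  interpret w: wo_rel w using W by (simp add: wo_rel_def)
  have refl: "le x x" for x
    unfolding le_def using r.REFL w.REFL W(2) by (auto simp: refl_on_def)
  have trans: "le x y \<Longrightarrow> le y z \<Longrightarrow> le x z" for x y z
    unfolding le_def using transD[OF r.TRANS] transD[OF w.TRANS] by (auto split: if_splits)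
  have anti: "le x y \<Longrightarrow> le y x \<Longrightarrow> x = y" for x y
    unfolding le_def using antisymD[OF r.ANTISYM] antisymD[OF w.ANTISYM] by (auto split: if_splits)
  have lin: "le x y \<or> le y x" for x y
  proof (cases "x \<in> Field r \<and> y \<in> Field r")
    case True
    then show ?thesis using r.TOTALS unfolding le_def by auto
  next
    case False
    then show ?thesis using w.TOTALS W(2) unfolding le_def by auto
  qed
  have ind: "P a" if step: "\<And>x. (\<And>y. lt y x \<Longrightarrow> P y) \<Longrightarrow> P x" for P and a :: 'a
  proof -
    have F: "P x" if "x \<in> Field r" for x
      using r.WF that
    proof (induction x rule: wf_induct_rule)
      case (less x)
      show ?case
      proof (rule step)
        fix y assume "lt y x"
        then have "y \<in> Field r" "(y, x) \<in> r - Id"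
          using less.prems unfolding lt_def le_def by (auto split: if_splits)
        then show "P y" using less.IH by blast
      qed
    qed
    show ?thesis
      using w.WF
    proof (induction a rule: wf_induct_rule)
      case (less x)
      show ?case
      proof (rule step)
        fix y assume y: "lt y x"
        show "P y"
        proof (cases "y \<in> Field r")
          case False
          then have "(y, x) \<in> w - Id" using y unfolding lt_def le_def by (auto split: if_splits)
          then show ?thesis using less.IH by blast
        qed (rule F)
      qed
    qed
  qed
  have "class.wellorder le lt"
  proof unfold_locales
    fix P and a :: 'a assume "\<And>x. (\<And>y. lt y x \<Longrightarrow> P y) \<Longrightarrow> P x"
    then show "P a" by (rule ind)
  qed (use refl trans anti lin in \<open>auto simp: lt_def\<close>)
  then show thesis
    using that[of le lt] unfolding le_def by auto
qed

text \<open>A set of smaller size is not cofinal, hence weakly bounded; the bound becomes strict as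
  an infinite cardinal has no largest element.\<close>

lemma regularCard_strict_bound:
  assumes "Cinfinite r" "regularCard r" "X \<subseteq> Field r" "|X| <o r"
  shows "\<exists>z\<in>Field r. \<forall>x\<in>X. x \<noteq> z \<and> (x, z) \<in> r"
proof -
  have W: "Well_order r" using assms(1) by (simp add: card_order_on_well_order_on)
  interpret R: wo_rel r using W by (simp add: wo_rel_def)
  have "\<not> cofinal X r"
    using assms not_ordLess_ordIso[OF assms(4)] unfolding regularCard_def by blast
  then obtain a where a: "a \<in> Field r" "\<forall>b\<in>X. \<not> (a \<noteq> b \<and> (a, b) \<in> r)" unfolding cofinal_def by blast
  obtain z where z: "z \<in> Field r" "a \<noteq> z" "(a, z) \<in> r"
    using infinite_Card_order_limit[of r a] assms(1) a(1) unfolding cinfinite_def by blast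
  have "x \<noteq> z \<and> (x, z) \<in> r" if "x \<in> X" for x
  proof -
    have "(x, a) \<in> r" using R.in_notinI[of a x] a that assms(3) by blast
    then show ?thesis using z transD[OF R.TRANS] antisymD[OF R.ANTISYM] by blast
  qed
  then show ?thesis using z(1) by blast
qed

lemma Field_seg: "Well_order r \<Longrightarrow> Field (seg r a) = underS r a"
  unfolding seg_def using Refl_Field_Restr2[of r "underS r a"] Order_Relation.underS_Field[of r a]
  by (simp add: order_on_defs)

lemma Well_order_seg: "Well_order r \<Longrightarrow> Well_order (seg r a)"
  unfolding seg_def by (rule Well_order_Restr)

lemma underS_trans:
  "Well_order r \<Longrightarrow> b \<in> underS r a \<Longrightarrow> c \<in> underS r b \<Longrightarrow> c \<in> underS r a"
  unfolding underS_def order_on_defs by (auto dest: transD antisymD)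

lemma underS_seg: "Well_order r \<Longrightarrow> b \<in> underS r a \<Longrightarrow> underS (seg r a) b = underS r b"
  using underS_trans[of r b a] unfolding seg_def underS_def by blast

lemma card_underS_less:
  assumes "Well_order r" "Card_order (seg r a)" "b \<in> underS r a"
  shows "|underS r b| <o |underS r a|"
proof -
  have "|underS r b| <o seg r a"
    using card_of_underS[OF assms(2), of b] assms by (simp add: Field_seg underS_seg)
  moreover have "seg r a =o |underS r a|"
    using card_of_Field_ordIso[OF assms(2)] assms(1) by (simp add: Field_seg ordIso_symmetric)
  ultimately show ?thesis by (rule ordLess_ordIso_trans)
qed

text \<open>A cofinal \<open>X\<close> would be nonempty, hence an image of
  \<open>underS r j\<close>, against the minimality of \<open>cf r\<close>.\<close>

lemma not_cofinal_if_less_cf: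
  assumes W: "Well_order r" and j: "j \<in> underS r (cf r)" and X: "X \<subseteq> Field r" "|X| \<le>o |underS r j|"
  shows "\<not> cofinal X r"
proof
  assume cof: "cofinal X r"
  interpret R: wo_rel r using W by (simp add: wo_rel_def)
  have jF: "j \<in> Field r" using j Order_Relation.underS_Field[of r "cf r"] by blast
  then have "X \<noteq> {}" using cof unfolding cofinal_def by blast
  then obtain g where g: "g ` underS r j = X" using X(2) card_of_ordLeq2[of X "underS r j"] by blast
  let ?C = "{c \<in> Field r. \<exists>g \<in> underS r c \<rightarrow> Field r. cofinal (g ` underS r c) r}"
  have "g \<in> underS r j \<rightarrow> Field r" using g X(1) by blast
  then have "j \<in> ?C" using cof g jF by blast
  then have "(cf r, j) \<in> r" unfolding cf_def by (intro R.minim_least) auto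
  then show False using j antisymD[OF R.ANTISYM] unfolding underS_def by blast
qed

text \<open>The main point is that \<open>cf \<mu>\<close> is a regular cardinal, which is derived
  from its minimality through the strictly increasing cofinal map \<open>M\<close>.\<close>

lemma singular_scale_of_scale:
  fixes \<mu> :: "'a rel"
  assumes sing: "singular_card \<mu>" and sc: "scale \<mu> M F"
    and woA: "class.wellorder lea lta"
    and leA: "\<And>x y. x \<in> Field \<mu> \<Longrightarrow> y \<in> Field \<mu> \<Longrightarrow> lea x y \<longleftrightarrow> (x, y) \<in> \<mu>"
    and woL: "class.wellorder lel ltl"
    and leL: "\<And>x y. x \<in> Field (cardSuc \<mu>) \<Longrightarrow> y \<in> Field (cardSuc \<mu>) \<Longrightarrow> lel x y \<longleftrightarrow> (x, y) \<in> cardSuc \<mu>"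
  shows "singular_scale lel ltl lea lta (Field (cardSuc \<mu>)) (underS \<mu> (cf \<mu>)) (Field \<mu>)
    (\<lambda>i. underS \<mu> (M i)) F"
proof -
  interpret A: wellorder lea lta by (rule woA)
  interpret L: wellorder lel ltl by (rule woL)
  have Cinf: "Cinfinite \<mu>" using sing by (simp add: singular_card_def)
  then have Card: "Card_order \<mu>" and W: "Well_order \<mu>" by (simp_all add: card_order_on_well_order_on)
  have CinfS: "Cinfinite (cardSuc \<mu>)" using Cinf by (rule Cinfinite_cardSuc)
  define K where "K = underS \<mu> (cf \<mu>)"
  define Mu where "Mu i = underS \<mu> (M i)" for i
  let ?L = "Field (cardSuc \<mu>)"
  have ltA: "lta x y \<longleftrightarrow> x \<in> underS \<mu> y" if "x \<in> Field \<mu>" "y \<in> Field \<mu>" for x y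
    using leA[OF that] by (auto simp: A.less_le underS_def)
  have ltL: "ltl x y \<longleftrightarrow> x \<in> underS (cardSuc \<mu>) y" if "x \<in> ?L" "y \<in> ?L" for x y
    using leL[OF that] by (auto simp: L.less_le underS_def)
  have KF: "K \<subseteq> Field \<mu>" unfolding K_def by (rule Order_Relation.underS_Field)
  have MuF: "Mu i \<subseteq> Field \<mu>" for i unfolding Mu_def by (rule Order_Relation.underS_Field)
  have M: "M i \<in> Field \<mu>" "Cinfinite (seg \<mu> (M i))" "regularCard (seg \<mu> (M i))" if "i \<in> K" for i
    using sc that unfolding scale_def regular_card_def K_def by blast+
  have M_mono: "lta (M i) (M j)" "M i \<in> underS \<mu> (M j)" if "i \<in> K" "j \<in> K" "lta i j" for i j
  proof -
    have "i \<in> underS \<mu> j" using that ltA KF by blast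
    then show "M i \<in> underS \<mu> (M j)" using sc that unfolding scale_def K_def by blast
    then show "lta (M i) (M j)" using ltA M(1) that by blast
  qed
  have M_cof: "\<exists>i\<in>K. lta a (M i)" if "a \<in> Field \<mu>" for a
  proof -
    have "cofinal (M ` K) \<mu>" using sc unfolding scale_def K_def by blast
    then have "\<exists>b\<in>M ` K. a \<noteq> b \<and> (a, b) \<in> \<mu>" using that unfolding cofinal_def by (rule bspec)
    then obtain i where "i \<in> K" "a \<noteq> M i" "(a, M i) \<in> \<mu>" by (auto elim!: imageE)
    then show ?thesis using leA[OF that M(1)] A.less_le by blast
  qed
  have M_less_iff: "lta i j" if "i \<in> K" "j \<in> K" "lta (M i) (M j)" for i j
  proof (rule ccontr)
    assume "\<not> lta i j"
    then have "i = j \<or> lta j i" by auto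
    then have "lea (M j) (M i)" using M_mono(1)[OF that(2,1)] by auto
    then show False using that(3) by simp
  qed
  have not_cof: "\<exists>a\<in>Field \<mu>. \<forall>x\<in>X. lea (M x) a" if X: "X \<subseteq> K" "|X| \<le>o |underS \<mu> j|" and j: "j \<in> K" for X j
  proof -
    have MX: "M ` X \<subseteq> Field \<mu>" using X(1) M(1) by blast
    have "\<not> cofinal (M ` X) \<mu>"
      by (rule not_cofinal_if_less_cf[OF W j[unfolded K_def] MX ordLeq_transitive[OF card_of_image X(2)]])
    then obtain a where a: "a \<in> Field \<mu>" "\<forall>b\<in>M ` X. \<not> (a \<noteq> b \<and> (a, b) \<in> \<mu>)" unfolding cofinal_def by blast
    have "lea (M x) a" if x: "x \<in> X" for x
    proof (rule ccontr)
      assume "\<not> lea (M x) a"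
      then have "lta a (M x)" by simp
      then have "a \<noteq> M x \<and> (a, M x) \<in> \<mu>" using leA[OF a(1)] MX x by (auto simp: A.less_le)
      then show False using a(2) x by blast
    qed
    then show ?thesis using a(1) by blast
  qed
  have K_ne: "K \<noteq> {}"
  proof -
    have "Field \<mu> \<noteq> {}" using Cinf unfolding cinfinite_def by auto
    then show ?thesis using M_cof by blast
  qed
  have K_gr: "\<exists>i\<in>K. lta j i" if j: "j \<in> K" for j
    using M_cof[OF M(1)[OF j]] M_less_iff[OF j] by blast
  have K_infinite: "infinite K"
    using finite_transitivity_chain[of K lta] K_gr K_ne A.less_trans by blast
  have segK: "{i\<in>K. lta i j} = underS \<mu> j" if j: "j \<in> K" for j
    using ltA KF j underS_trans[OF W j[unfolded K_def]] Order_Relation.underS_Field[of \<mu> j] unfolding K_def by blast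
  have K_seg: "|{i\<in>K. lta i j}| <o |K|" if j: "j \<in> K" for j
  proof (rule ccontr)
    assume "\<not> ?thesis"
    then have "|K| \<le>o |underS \<mu> j|"
      using not_ordLess_iff_ordLeq[OF card_of_Well_order card_of_Well_order] segK[OF j] by auto
    then obtain a where a: "a \<in> Field \<mu>" "\<forall>x\<in>K. lea (M x) a" using not_cof[of K j] j by blast
    obtain i where "i \<in> K" "lta a (M i)" using M_cof[OF a(1)] by blast
    with a(2) show False using A.not_less by blast
  qed
  \<comment> \<open>\<open>S\<close> is no larger than some \<open>underS \<mu> c\<close> with
    \<open>c\<close> in \<open>K\<close>, so \<open>M\<close> is bounded on \<open>S\<close> by
    \<open>not_cof\<close>, and an index whose \<open>M\<close> value exceeds that bound lies beyond
    \<open>S\<close>.\<close>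
  have K_bdd: "\<exists>j\<in>K. \<forall>c\<in>S. lta c j" if S: "S \<subseteq> K" "|S| <o |K|" for S
  proof -
    have wK: "Well_order (seg \<mu> (cf \<mu>))" and fK: "Field (seg \<mu> (cf \<mu>)) = K"
      using Well_order_seg[OF W] Field_seg[OF W] unfolding K_def by auto
    have "|K| \<le>o seg \<mu> (cf \<mu>)" using card_of_least[of K "seg \<mu> (cf \<mu>)"] wK fK by simp
    then have "|S| <o seg \<mu> (cf \<mu>)" using S(2) ordLess_ordLeq_trans by blast
    then obtain c where c: "c \<in> K" "|S| =o Restr (seg \<mu> (cf \<mu>)) (underS (seg \<mu> (cf \<mu>)) c)"
      using ordLess_iff_ordIso_Restr[OF wK card_of_Well_order] fK by blast
    have "Field (Restr (seg \<mu> (cf \<mu>)) (underS (seg \<mu> (cf \<mu>)) c)) = underS \<mu> c"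
      using Field_seg[OF wK, of c] underS_seg[OF W, of c "cf \<mu>"] c(1) unfolding K_def seg_def[symmetric] by simp
    then have "|S| \<le>o |underS \<mu> c|"
      using ordIso_imp_ordLeq[OF card_of_cong[OF c(2)]] by (simp add: Field_card_of)
    then obtain a where a: "a \<in> Field \<mu>" "\<forall>x\<in>S. lea (M x) a" using not_cof[OF S(1) _ c(1)] by blast
    obtain i where i: "i \<in> K" "lta a (M i)" using M_cof[OF a(1)] by blast
    have "lta x i" if "x \<in> S" for x
    proof (rule M_less_iff)
      show "x \<in> K" using S that by blast
      have "lea (M x) a" using a(2) that by blast
      then show "lta (M x) (M i)" using i(2) by order
    qed (rule i(1))
    then show ?thesis using i(1) by blast
  qed
  have Mu_card: "Card_order (seg \<mu> (M i))" if "i \<in> K" for i using M(2)[OF that] by simp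
  have Mu_less: "|Mu i| <o |Mu j|" if "i \<in> K" "j \<in> K" "lta i j" for i j
    unfolding Mu_def by (rule card_underS_less[OF W Mu_card M_mono(2)]) (use that in auto)
  have Mu_mono: "Mu i \<subseteq> Mu j" if "i \<in> K" "j \<in> K" "lta i j" for i j
    unfolding Mu_def using underS_trans[OF W M_mono(2)[OF that]] by blast
  \<comment> \<open>The scale places \<open>cf \<mu>\<close> below the value of \<open>M\<close> at
    the ordinal 0; monotonicity carries the inequality to all \<open>i\<close>.\<close>
  have K_Mu: "|K| <o |Mu i|" if i: "i \<in> K" for i
  proof -
    interpret R: wo_rel \<mu> using W by (simp add: wo_rel_def)
    define z where "z = wo_rel.minim \<mu> (Field \<mu>)"
    have z: "z \<in> Field \<mu>" "(z, i) \<in> \<mu>" "cf \<mu> \<in> underS \<mu> (M z)"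
      using R.minim_inField[of "Field \<mu>"] R.minim_least[of "Field \<mu>" i] i KF sc
      unfolding z_def scale_def by blast+
    have zi: "z = i \<or> z \<in> underS \<mu> i" using z(2) unfolding underS_def by blast
    have zK: "z \<in> K" using zi i underS_trans[OF W] unfolding K_def by blast
    have "|K| <o |Mu z|"
      unfolding K_def Mu_def by (rule card_underS_less[OF W Mu_card[OF zK] z(3)])
    moreover have "z = i \<or> |Mu z| <o |Mu i|" using zi Mu_less[OF zK i] ltA[OF z(1)] KF i by blast
    ultimately show ?thesis using ordLess_transitive by blast
  qed
  have Mu_bdd: "\<exists>b\<in>Mu i. \<forall>c\<in>S. lta c b" if i: "i \<in> K" and S: "S \<subseteq> Mu i" "|S| <o |Mu i|" for i S
  proof -
    have "|Mu i| =o seg \<mu> (M i)"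
      using card_of_Field_ordIso[OF Mu_card[OF i]] Field_seg[OF W] unfolding Mu_def by simp
    then have "|S| <o seg \<mu> (M i)" using S(2) ordLess_ordIso_trans by blast
    then obtain z where z: "z \<in> Mu i" "\<forall>x\<in>S. x \<noteq> z \<and> (x, z) \<in> seg \<mu> (M i)"
      using regularCard_strict_bound[OF M(2)[OF i] M(3)[OF i], of S] S(1) Field_seg[OF W]
      unfolding Mu_def by auto
    have "lta x z" if "x \<in> S" for x
      using ltA[of x z] z that S(1) MuF[of i] unfolding seg_def underS_def by blast
    then show ?thesis using z(1) by blast
  qed
  have Mu_N: "(\<Union>i\<in>K. Mu i) = Field \<mu>"
  proof
    show "(\<Union>i\<in>K. Mu i) \<subseteq> Field \<mu>" using MuF by blast
    show "Field \<mu> \<subseteq> (\<Union>i\<in>K. Mu i)"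
    proof
      fix a assume a: "a \<in> Field \<mu>"
      then obtain i where i: "i \<in> K" "lta a (M i)" using M_cof by blast
      then have "a \<in> Mu i" using ltA[OF a M(1)[OF i(1)]] unfolding Mu_def by blast
      then show "a \<in> (\<Union>i\<in>K. Mu i)" using i(1) by blast
    qed
  qed
  have N: "|Field \<mu>| =o \<mu>" by (rule card_of_Field_ordIso[OF Card])
  have L_bdd: "\<exists>z\<in>?L. \<forall>x\<in>X. ltl x z" if X: "X \<subseteq> ?L" "|X| \<le>o |Field \<mu>|" for X
  proof -
    have "|X| \<le>o \<mu>" using X(2) N ordLeq_ordIso_trans by blast
    then have "|X| <o cardSuc \<mu>" using cardSuc_greater[OF Card] ordLeq_ordLess_trans by blast
    then obtain z where z: "z \<in> ?L" "\<forall>x\<in>X. x \<noteq> z \<and> (x, z) \<in> cardSuc \<mu>"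
      using regularCard_strict_bound[OF CinfS regularCard_cardSuc[OF Cinf] X(1)] by blast
    have "ltl x z" if "x \<in> X" for x
      using ltL[of x z] z that X(1) unfolding underS_def by blast
    then show ?thesis using z(1) by blast
  qed
  have L_seg: "|{y\<in>?L. ltl y x}| \<le>o |Field \<mu>|" if x: "x \<in> ?L" for x
  proof -
    have "{y\<in>?L. ltl y x} \<subseteq> underS (cardSuc \<mu>) x" using ltL x by blast
    then have 1: "|{y\<in>?L. ltl y x}| \<le>o |underS (cardSuc \<mu>) x|" by (rule card_of_mono1)
    have "|underS (cardSuc \<mu>) x| <o cardSuc \<mu>"
      using card_of_underS[OF cardSuc_Card_order[OF Card] x] .
    then have "|underS (cardSuc \<mu>) x| \<le>o \<mu>"
      using cardSuc_ordLeq_ordLess[OF Card card_of_Card_order] by blast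
    then have "|underS (cardSuc \<mu>) x| \<le>o |Field \<mu>|" using N ordIso_symmetric ordLeq_ordIso_trans by blast
    with 1 show ?thesis by (rule ordLeq_transitive)
  qed
  have star: "\<exists>j\<in>K. \<forall>i\<in>K. lta j i \<longrightarrow> lta (g i) (g' i)"
    if st: "less_star \<mu> g g'" "\<forall>i\<in>K. g i \<in> Field \<mu> \<and> g' i \<in> Field \<mu>" for g g'
  proof -
    have "Field (seg \<mu> (cf \<mu>)) = K" using Field_seg[OF W] unfolding K_def .
    then obtain j where j: "j \<in> K" "\<forall>i\<in>{i\<in>K. (g' i, g i) \<in> \<mu>}. (i, j) \<in> seg \<mu> (cf \<mu>)"
      using st(1) unfolding less_star_def bounded_in_def K_def by auto
    have "lta (g i) (g' i)" if i: "i \<in> K" "lta j i" for i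
    proof (rule ccontr)
      assume "\<not> lta (g i) (g' i)"
      then have "(g' i, g i) \<in> \<mu>" using leA[of "g' i" "g i"] st(2) i(1) by auto
      then have "(i, j) \<in> \<mu>" using j(2) i(1) unfolding seg_def by blast
      then have "lea i j" using leA[of i j] i(1) j(1) KF by blast
      then show False using i(2) by simp
    qed
    then show ?thesis using j(1) by blast
  qed
  have f_Mu: "F x i \<in> Mu i" if "x \<in> ?L" "i \<in> K" for x i
    using sc that unfolding scale_def K_def Mu_def by blast
  have f_less: "\<exists>j\<in>K. \<forall>i\<in>K. lta j i \<longrightarrow> lta (F x i) (F y i)" if "x \<in> ?L" "y \<in> ?L" "ltl x y" for x y
  proof (rule star)
    show "less_star \<mu> (F x) (F y)" using sc ltL[OF that(1,2)] that unfolding scale_def by blast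
    show "\<forall>i\<in>K. F x i \<in> Field \<mu> \<and> F y i \<in> Field \<mu>" using f_Mu that MuF by blast
  qed
  have f_dom: "\<exists>x\<in>?L. \<exists>j\<in>K. \<forall>i\<in>K. lta j i \<longrightarrow> lta (g i) (F x i)" if g: "\<forall>i\<in>K. g i \<in> Mu i" for g
  proof -
    have "g \<in> (\<Pi> i\<in>K. Mu i)" using g by blast
    then obtain x where x: "x \<in> ?L" "less_star \<mu> g (F x)"
      using sc unfolding scale_def K_def Mu_def by blast
    have "\<exists>j\<in>K. \<forall>i\<in>K. lta j i \<longrightarrow> lta (g i) (F x i)"
      by (rule star[OF x(2)]) (use g f_Mu[OF x(1)] MuF in blast)
    then show ?thesis using x(1) by blast
  qed
  have "singular_scale lel ltl lea lta ?L K (Field \<mu>) Mu F"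
    by (intro singular_scale.intro singular_scale_axioms.intro woA woL)
      (fact L_bdd L_seg K_infinite K_bdd K_seg K_Mu Mu_bdd Mu_less Mu_mono Mu_N f_Mu f_less f_dom)+
  then show ?thesis unfolding K_def Mu_def .
qed

section \<open>The theorem for arbitrary disjoint families\<close>

theorem theorem6p5:
  fixes \<mu> :: "'a rel" and M :: "'a \<Rightarrow> 'a" and F :: "'a set \<Rightarrow> 'a \<Rightarrow> 'a"
  assumes "singular_card \<mu>"
    and "scale \<mu> M F"
    and "\<forall>i \<in> underS \<mu> (cf \<mu>). neg_rect_partition (seg \<mu> (M i))"
  shows "Pr1 (cardSuc \<mu>) (cardSuc \<mu>) (cardSuc \<mu>) (seg \<mu> (cf \<mu>))"
proof -
  have Cinf: "Cinfinite \<mu>" using assms(1) by (simp add: singular_card_def)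
  then have W: "Well_order \<mu>" by (simp add: card_order_on_well_order_on)
  have WS: "Well_order (cardSuc \<mu>)"
    using Cinf by (simp add: card_order_on_well_order_on cardSuc_Card_order)
  obtain lea lta where A: "class.wellorder lea lta"
    "\<And>x y. x \<in> Field \<mu> \<Longrightarrow> y \<in> Field \<mu> \<Longrightarrow> lea x y \<longleftrightarrow> (x, y) \<in> \<mu>"
    by (rule wellorder_extension[OF W]) blast
  obtain lel ltl where L: "class.wellorder lel ltl"
    "\<And>x y. x \<in> Field (cardSuc \<mu>) \<Longrightarrow> y \<in> Field (cardSuc \<mu>) \<Longrightarrow> lel x y \<longleftrightarrow> (x, y) \<in> cardSuc \<mu>"
    by (rule wellorder_extension[OF WS]) blast
  define K where "K = underS \<mu> (cf \<mu>)"
  define Mu where "Mu i = underS \<mu> (M i)" for i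
  define Lam where "Lam = Field (cardSuc \<mu>)"
  interpret S: singular_scale lel ltl lea lta Lam K "Field \<mu>" Mu F
    unfolding K_def Mu_def Lam_def by (rule singular_scale_of_scale[OF assms(1,2) A L])
  have "\<forall>i\<in>K. \<exists>d. \<forall>A B. A \<subseteq> Mu i \<and> B \<subseteq> Mu i \<and> cofinal A (seg \<mu> (M i)) \<and> cofinal B (seg \<mu> (M i)) \<longrightarrow>
      (\<forall>\<sigma>\<in>Mu i. \<exists>\<alpha>\<in>A. \<exists>\<beta>\<in>B. d {\<alpha>, \<beta>} = \<sigma>)"
  proof
    fix i assume "i \<in> K"
    then have "neg_rect_partition (seg \<mu> (M i))" using assms(3) unfolding K_def by blast
    then obtain d where "\<forall>A B. A \<subseteq> Mu i \<and> B \<subseteq> Mu i \<and> cofinal A (seg \<mu> (M i)) \<and> cofinal B (seg \<mu> (M i)) \<longrightarrow>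
        (\<forall>\<sigma>\<in>Mu i. \<exists>\<alpha>\<in>A. \<exists>\<beta>\<in>B. \<alpha> \<noteq> \<beta> \<and> d {\<alpha>, \<beta>} = \<sigma>)"
      unfolding neg_rect_partition_def Field_seg[OF W] Mu_def[symmetric] by (elim bexE)
    then show "\<exists>d. \<forall>A B. A \<subseteq> Mu i \<and> B \<subseteq> Mu i \<and> cofinal A (seg \<mu> (M i)) \<and> cofinal B (seg \<mu> (M i)) \<longrightarrow>
        (\<forall>\<sigma>\<in>Mu i. \<exists>\<alpha>\<in>A. \<exists>\<beta>\<in>B. d {\<alpha>, \<beta>} = \<sigma>)" by (intro exI[of _ d]) meson
  qed
  from bchoice[OF this] obtain d where d: "\<forall>i\<in>K. \<forall>A B. A \<subseteq> Mu i \<and> B \<subseteq> Mu i \<and>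
      cofinal A (seg \<mu> (M i)) \<and> cofinal B (seg \<mu> (M i)) \<longrightarrow> (\<forall>\<sigma>\<in>Mu i. \<exists>\<alpha>\<in>A. \<exists>\<beta>\<in>B. d i {\<alpha>, \<beta>} = \<sigma>)"
    by blast
  define dd where "dd k x y = d k {x, y}" for k x y
  have unb_cof: "cofinal S (seg \<mu> (M k))"
    if k: "k \<in> K" and S: "S \<subseteq> Mu k" "\<forall>z\<in>Mu k. \<exists>x\<in>S. lta z x" for k S
    unfolding cofinal_def Field_seg[OF W] Mu_def[symmetric]
  proof
    fix z assume z: "z \<in> Mu k"
    then obtain x where x: "x \<in> S" "lta z x" using S(2) by blast
    then have xz: "x \<in> Mu k" "lea z x" "z \<noteq> x" using S(1) by auto
    then have "(z, x) \<in> \<mu>" using A(2)[of z x] z S.Mu_subset[OF k] by blast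
    then have "(z, x) \<in> seg \<mu> (M k)" using z xz(1) unfolding seg_def Mu_def by blast
    then show "\<exists>b\<in>S. z \<noteq> b \<and> (z, b) \<in> seg \<mu> (M k)" using x(1) xz(3) by blast
  qed
  have rect: "\<exists>x\<in>S. \<exists>y\<in>T. dd k x y = \<sigma>"
    if "k \<in> K" "S \<subseteq> Mu k" "T \<subseteq> Mu k" "\<forall>z\<in>Mu k. \<exists>x\<in>S. lta z x" "\<forall>z\<in>Mu k. \<exists>x\<in>T. lta z x" "\<sigma> \<in> Mu k"
    for k S T \<sigma>
    using d that unb_cof[of k S] unb_cof[of k T] unfolding dd_def by simp
  obtain h where h: "S.codes h" using S.ex_codes by blast
  obtain z0 where z0: "z0 \<in> Lam" using S.L_bdd[of "{}"] card_of_empty by blast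
  \<comment> \<open>Passes from ordered to unordered pairs: exactly one enumeration of a two-element
    set is increasing.\<close>
  define g where "g Z = (THE v. \<exists>a b. Z = {a, b} \<and> ltl a b \<and> v = S.colour h dd a b)" for Z
  have g: "g {a, b} = S.colour h dd a b" if "ltl a b" for a b
    unfolding g_def by (rule the_equality) (use that in \<open>auto simp: doubleton_eq_iff\<close>)
  \<comment> \<open>The default \<open>z0\<close> keeps the colours inside \<lambda>.\<close>
  define c where "c Z = (if g Z \<in> Lam then g Z else z0)" for Z
  have "c \<in> nsets Lam 2 \<rightarrow> Lam" using z0 unfolding c_def by auto
  moreover have "\<exists>\<beta>\<in>Lam. \<exists>\<alpha>\<in>underS (cardSuc \<mu>) \<beta>. \<forall>a\<in>t \<alpha>. \<forall>b\<in>t \<beta>. c {a, b} = \<epsilon>"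
    if t: "\<forall>\<alpha>\<in>Lam. t \<alpha> \<subseteq> Lam \<and> |t \<alpha>| <o seg \<mu> (cf \<mu>)" "disjoint_family_on t Lam" and \<epsilon>: "\<epsilon> \<in> Lam" for t \<epsilon>
  proof -
    \<comment> \<open>The hypothesis compares with the ordinal \<open>cf \<mu>\<close>, not with
      \<open>|K|\<close>. If \<open>t \<alpha>\<close> were as large as \<open>K\<close>, then
      \<open>|K|\<close> would be isomorphic to a proper initial segment, against
      \<open>S.K_seg\<close>.\<close>
    have tK: "|t \<alpha>| <o |K|" if "\<alpha> \<in> Lam" for \<alpha>
    proof (rule ccontr)
      assume "\<not> ?thesis"
      then have 1: "|K| \<le>o |t \<alpha>|"
        using not_ordLess_iff_ordLeq[OF card_of_Well_order card_of_Well_order] by blast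
      have wK: "Well_order (seg \<mu> (cf \<mu>))" and fK: "Field (seg \<mu> (cf \<mu>)) = K"
        using Well_order_seg[OF W] Field_seg[OF W] unfolding K_def by auto
      have "|K| <o seg \<mu> (cf \<mu>)" using 1 t(1) that ordLeq_ordLess_trans by blast
      then obtain j where j: "j \<in> K" "|K| =o Restr (seg \<mu> (cf \<mu>)) (underS (seg \<mu> (cf \<mu>)) j)"
        using ordLess_iff_ordIso_Restr[OF wK card_of_Well_order] fK by blast
      have "Field (Restr (seg \<mu> (cf \<mu>)) (underS (seg \<mu> (cf \<mu>)) j)) = underS \<mu> j"
        using Field_seg[OF wK, of j] underS_seg[OF W, of j "cf \<mu>"] j(1)
        unfolding K_def seg_def[symmetric] by simp
      then have 2: "|K| \<le>o |underS \<mu> j|"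
        using ordIso_imp_ordLeq[OF card_of_cong[OF j(2)]] by (simp add: Field_card_of)
      have "underS \<mu> j \<subseteq> {i\<in>K. lta i j}"
      proof
        fix i assume i: "i \<in> underS \<mu> j"
        then have "i \<in> K" using underS_trans[OF W] j(1) unfolding K_def by blast
        moreover have "lea i j" "i \<noteq> j"
          using A(2)[of i j] i j(1) Order_Relation.underS_Field[of \<mu>] unfolding K_def underS_def by blast+
        ultimately show "i \<in> {i\<in>K. lta i j}" by auto
      qed
      then have "|K| \<le>o |{i\<in>K. lta i j}|" by (rule ordLeq_transitive[OF 2 card_of_mono1])
      then show False using S.K_seg[OF j(1)] not_ordLeq_ordLess[of "|K|"] by blast
    qed
    \<comment> \<open>By disjointness at most \<open>|N|\<close> of the sets
      \<open>t \<alpha>\<close> contain an ordinal below \<open>x\<close>, so some later one lies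
      entirely at or above \<open>x\<close>.\<close>
    have "\<forall>x\<in>Lam. \<exists>\<alpha>. \<alpha> \<in> Lam \<and> ltl x \<alpha> \<and> t \<alpha> \<subseteq> {y\<in>Lam. lel x y}"
    proof
      fix x assume x: "x \<in> Lam"
      let ?bad = "{\<alpha>\<in>Lam. \<exists>y\<in>t \<alpha>. ltl y x}"
      have "\<forall>\<alpha>\<in>?bad. \<exists>y. y \<in> t \<alpha> \<and> ltl y x" by blast
      from bchoice[OF this] obtain w where w: "\<forall>\<alpha>\<in>?bad. w \<alpha> \<in> t \<alpha> \<and> ltl (w \<alpha>) x" by blast
      have "inj_on w ?bad"
      proof (rule inj_onI)
        fix \<alpha> \<beta> assume ab: "\<alpha> \<in> ?bad" "\<beta> \<in> ?bad" "w \<alpha> = w \<beta>"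
        then have "w \<alpha> \<in> t \<alpha> \<inter> t \<beta>" using w by auto
        then show "\<alpha> = \<beta>" using t(2) ab(1,2) unfolding disjoint_family_on_def by blast
      qed
      moreover have "w ` ?bad \<subseteq> {y\<in>Lam. ltl y x}" using w t(1) by blast
      ultimately have "|?bad| \<le>o |{y\<in>Lam. ltl y x}|" by (intro card_of_ordLeq[THEN iffD1] exI conjI)
      then have "|?bad| \<le>o |Field \<mu>|" using S.L_seg[OF x] by (rule ordLeq_transitive)
      then have "|{x} \<union> ?bad| \<le>o |Field \<mu>|"
        by (rule card_of_Un_le[OF S.N_infinite card_of_singleton_le[OF S.N_infinite]])
      moreover have "{x} \<union> ?bad \<subseteq> Lam" using x by blast
      ultimately obtain \<alpha> where \<alpha>: "\<alpha> \<in> Lam" "\<forall>y\<in>{x} \<union> ?bad. ltl y \<alpha>" using S.L_bdd by blast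
      then have "\<alpha> \<notin> ?bad" by auto
      then have "\<forall>y\<in>t \<alpha>. \<not> ltl y x" using \<alpha>(1) by blast
      then have "t \<alpha> \<subseteq> {y\<in>Lam. lel x y}" using t(1) \<alpha>(1) by auto
      then show "\<exists>\<alpha>. \<alpha> \<in> Lam \<and> ltl x \<alpha> \<and> t \<alpha> \<subseteq> {y\<in>Lam. lel x y}" using \<alpha> by blast
    qed
    from bchoice[OF this] obtain T
      where T: "\<forall>x\<in>Lam. T x \<in> Lam \<and> ltl x (T x) \<and> t (T x) \<subseteq> {y\<in>Lam. lel x y}" by blast
    have fam: "S.family (\<lambda>x. t (T x))" unfolding S.family_def using T tK by blast
    have TL: "T x \<in> Lam" if "x \<in> Lam" for x using T that by blast
    \<comment> \<open>With \<open>T\<close> in the role of \<open>p\<close>, the index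
      \<open>T x\<close> lies below \<open>y\<close> and hence below \<open>T y\<close>.\<close>
    have "\<exists>x\<in>Lam. \<exists>y\<in>Lam. ltl (T x) y \<and> (\<forall>a\<in>t (T x). \<forall>b\<in>t (T y). ltl a b \<and> S.colour h dd a b = \<epsilon>)"
      by (rule S.colour_realised[OF h _ fam \<epsilon>]) (fact rect TL)+
    then obtain x y where xy: "x \<in> Lam" "y \<in> Lam" "ltl (T x) y"
      "\<forall>a\<in>t (T x). \<forall>b\<in>t (T y). ltl a b \<and> S.colour h dd a b = \<epsilon>"
      by blast
    have "ltl y (T y)" "T y \<in> Lam" "T x \<in> Lam" using T xy by blast+
    with xy(3) have "ltl (T x) (T y)" by order
    then have "T x \<in> underS (cardSuc \<mu>) (T y)"
      using L(2)[of "T x" "T y"] \<open>T y \<in> Lam\<close> \<open>T x \<in> Lam\<close> unfolding Lam_def underS_def S.L.less_le by blast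
    moreover have "\<forall>a\<in>t (T x). \<forall>b\<in>t (T y). c {a, b} = \<epsilon>"
      using xy(4) g \<epsilon> unfolding c_def by simp
    ultimately show ?thesis using \<open>T y \<in> Lam\<close> by blast
  qed
  ultimately show ?thesis unfolding Pr1_def Lam_def by blast
qed

end
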